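(* Suppose that $U$ is the renewal measure of a (possibly killed) subordinator with positive drift $\delta$ and a Lévy measure $\mu$ on $(0,\infty)$ which is also assumed to have no atoms. For $x>0$ let $\overline\mu(x)=\mu(x,\infty)$ and $\eta(x)=-\int_0^x\overline\mu(y)\,\mathrm dy$. Then the renewal density $u$ of $U$ has the form $$u(x)=\sum_{n\ge 0}\frac{\eta^{*n}(x)}{\delta^{n+1}},\qquad x>0,$$ where $\eta^{*0}(\mathrm dx)=\delta_0(\mathrm dx)$ is the unit mass at $0$ (so that, as a function, $\eta^{*0}(x)=1$ for $x>0$), $\eta^{*1}=\eta$ and $\eta^{*(n+1)}(x)=-\int_0^x\eta^{*n}(x-y)\overline\mu(y)\,\mathrm dy$. Moreover $u$ is continuously differentiable on $(0,\infty)$ with $$u'(x)=\sum_{n\ge 0}\frac{(\eta^{*n})'(x)}{\delta^{n+1}},\qquad x>0.$$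
   Context: A subordinator is understood in the broad sense: a Lévy process $H=\{H_t:t\ge 0\}$ with $H_0=0$ and non-decreasing paths, possibly killed (sent to a cemetery state) at an independent exponentially distributed time. Its Lévy measure $\mu$ on $(0,\infty)$ satisfies $\int_{(0,\infty)}(1\wedge x)\,\mu(\mathrm dx)<\infty$ and describes only the jumps of the process within $(0,\infty)$; the drift coefficient is $\delta$. The renewal measure is $U(\mathrm dx)=E\bigl(\int_0^\infty\mathbf 1_{(H_t\in\mathrm dx)}\,\mathrm dt\bigr)$ on $[0,\infty)$. When $\delta>0$, $U$ is absolutely continuous with respect to Lebesgue measure (Kesten), with a density that has a version continuous for $x>0$; the renewal density $u$ is this version.
   Formalization: The tail μ(x,∞) is replaced by q + μ(x,∞), with q the killing rate (q = 0 without killing); as written the formula fails for q > 0: if μ = 0 then u(x) = e^{-qx/δ}/δ, while the stated series is the constant 1/δ. *)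

theory Defs
  imports "HOL-Probability.Probability"
begin

text \<open>The clauses on sample paths are only required almost surely. Left limits need no separate
  clause, since the paths are monotone.\<close>

definition subordinator :: "'a measure \<Rightarrow> (real \<Rightarrow> 'a \<Rightarrow> real) \<Rightarrow> bool" where
  "subordinator M H \<longleftrightarrow>
     prob_space M \<and>
     (\<forall>t\<ge>0. H t \<in> borel_measurable M) \<and>
     (AE \<omega> in M. H 0 \<omega> = 0) \<and>
     (AE \<omega> in M. mono_on {0..} (\<lambda>t. H t \<omega>)) \<and>
     (AE \<omega> in M. \<forall>t\<ge>0. ((\<lambda>s. H s \<omega>) \<longlongrightarrow> H t \<omega>) (at_right t)) \<and>
     (\<forall>(t :: nat \<Rightarrow> real) n. 0 \<le> t 0 \<and> mono t \<longrightarrow>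
        prob_space.indep_vars M (\<lambda>_. borel) (\<lambda>i \<omega>. H (t (Suc i)) \<omega> - H (t i) \<omega>) {..<n}) \<and>
     (\<forall>s\<ge>0. \<forall>t\<ge>0. distr M borel (\<lambda>\<omega>. H (s + t) \<omega> - H s \<omega>)
                   = distr M borel (\<lambda>\<omega>. H t \<omega> - H 0 \<omega>))"

definition subordinator_levy_measure :: "real measure \<Rightarrow> bool" where
  "subordinator_levy_measure \<mu> \<longleftrightarrow>
     sets \<mu> = sets borel \<and> emeasure \<mu> {..0} = 0 \<and> (\<integral>\<^sup>+x. ennreal (min 1 x) \<partial>\<mu>) < \<infinity>"

text \<open>The drift and the L\'evy measure are the characteristics in the L\'evy--Khintchine formula
  for the Laplace exponent of the process before killing.\<close>

definition has_drift_and_levy_measure ::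
    "'a measure \<Rightarrow> (real \<Rightarrow> 'a \<Rightarrow> real) \<Rightarrow> real \<Rightarrow> real measure \<Rightarrow> bool" where
  "has_drift_and_levy_measure M H \<delta> \<mu> \<longleftrightarrow>
     subordinator_levy_measure \<mu> \<and>
     (\<forall>t\<ge>0. \<forall>\<theta>\<ge>0. (LINT \<omega>|M. exp (- \<theta> * H t \<omega>))
        = exp (- t * (\<delta> * \<theta> + (LINT x|\<mu>. 1 - exp (- \<theta> * x)))))"

text \<open>An exponential time of rate \<open>q\<close>, independent of the whole process. For \<open>q = 0\<close> the
  condition on the distribution says that \<open>\<zeta> = \<infinity>\<close> almost surely, i.e. there is no killing.\<close>

definition killing_time ::
    "'a measure \<Rightarrow> (real \<Rightarrow> 'a \<Rightarrow> real) \<Rightarrow> real \<Rightarrow> ('a \<Rightarrow> ereal) \<Rightarrow> bool" where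
  "killing_time M H q \<zeta> \<longleftrightarrow>
     q \<ge> 0 \<and> \<zeta> \<in> borel_measurable M \<and>
     (\<forall>t\<ge>0. measure M {\<omega> \<in> space M. ereal t < \<zeta> \<omega>} = exp (- q * t)) \<and>
     prob_space.indep_set M
       (sets (vimage_algebra (space M) \<zeta> borel))
       (sets (vimage_algebra (space M) (\<lambda>\<omega>. \<lambda>t\<in>{0..}. H t \<omega>) (PiM {0..} (\<lambda>_. borel))))"

text \<open>The cemetery state is \<open>None\<close>.\<close>

definition killed :: "(real \<Rightarrow> 'a \<Rightarrow> real) \<Rightarrow> ('a \<Rightarrow> ereal) \<Rightarrow> real \<Rightarrow> 'a \<Rightarrow> real option" where
  "killed H \<zeta> t \<omega> = (if ereal t < \<zeta> \<omega> then Some (H t \<omega>) else None)"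

definition renewal_measure :: "'a measure \<Rightarrow> (real \<Rightarrow> 'a \<Rightarrow> real option) \<Rightarrow> real measure" where
  "renewal_measure M X = measure_of UNIV (sets borel)
     (\<lambda>A. \<integral>\<^sup>+\<omega>. (\<integral>\<^sup>+t\<in>{0..}. indicator (Some ` A) (X t \<omega>) \<partial>lborel) \<partial>M)"

text \<open>\<open>U\<close> is regarded as a measure on the real line that is carried by \<open>[0, \<infinity>)\<close>. Only the values
  of \<open>u\<close> on \<open>(0, \<infinity>)\<close> matter, and there they are determined by \<open>U\<close>.\<close>

definition is_renewal_density :: "real measure \<Rightarrow> (real \<Rightarrow> real) \<Rightarrow> bool" where
  "is_renewal_density U u \<longleftrightarrow>
     continuous_on {0<..} u \<and> (\<forall>x>0. u x \<ge> 0) \<and>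
     U = density lborel (\<lambda>x. indicator {0<..} x * ennreal (u x))"

text \<open>The tail \<open>q + \<mu>(x, \<infinity>)\<close> is the mass of \<open>(x, \<infinity>]\<close> under the L\'evy measure extended by an atom of
  mass \<open>q\<close> (the killing rate) at the cemetery. Without killing it is \<open>\<mu>(x, \<infinity>)\<close>. The term \<open>q\<close> cannot
  be omitted: for \<open>\<mu> = 0\<close> the renewal density is \<open>exp (- q * x / \<delta>) / \<delta>\<close>. At \<open>x = 0\<close>, where
  \<open>\<mu>(x, \<infinity>)\<close> may be infinite, the value is irrelevant.\<close>

definition levy_tail :: "real \<Rightarrow> real measure \<Rightarrow> real \<Rightarrow> real" where
  "levy_tail q \<mu> x = q + measure \<mu> {x<..}"

definition eta :: "real \<Rightarrow> real measure \<Rightarrow> real \<Rightarrow> real" where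
  "eta q \<mu> x = - (LINT y:{0..x}|lborel. levy_tail q \<mu> y)"

text \<open>\<open>eta_conv q \<mu> n\<close> is the \<open>n\<close>-th convolution power of \<open>eta q \<mu>\<close>, each step being a
  convolution with the measure \<open>d\<eta>\<close>.\<close>

primrec eta_conv :: "real \<Rightarrow> real measure \<Rightarrow> nat \<Rightarrow> real \<Rightarrow> real" where
  "eta_conv q \<mu> 0 = (\<lambda>x. 1)"
| "eta_conv q \<mu> (Suc n) =
     (\<lambda>x. - (LINT y:{0..x}|lborel. eta_conv q \<mu> n (x - y) * levy_tail q \<mu> y))"

lemma eta_conv_1: "eta_conv q \<mu> 1 = eta q \<mu>"
  by (simp add: eta_def fun_eq_iff)

end

theory Submission
  imports Defs
begin

text \<open>Write \<open>\<pi> = levy_tail q \<mu>\<close>, a decreasing function on \<open>(0, \<infinity>)\<close>, and \<open>L(s)\<close> for its Laplace transform.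
  The theorem is the Neumann series of \<open>1 / (s * (\<delta> + L(s)))\<close>, justified as follows.

  Fubini and the L\'evy--Khintchine formula give
  \<open>1 / (q + \<delta> * s + \<integral> (1 - exp (- s * x)) \<partial>\<mu>)\<close> as the transform of the renewal measure
  (\<open>laplace_renewal_measure\<close>). Integration by parts turns the denominator into
  \<open>s * (\<delta> + L(s))\<close> (\<open>laplace_levy_tail\<close>). On the other hand \<open>\<eta>\<^sup>*\<^sup>n\<close> is \<open>(-1)^n\<close> times the
  primitive of the \<open>n\<close>-th convolution power of \<open>\<pi>\<close>, with transform
  \<open>(- L(s))^n / s\<close>, and \<open>L(s)\<close> tends to \<open>0\<close> as \<open>s\<close> grows
  (\<open>levy_exponent_sublinear\<close>). Fix \<open>\<theta>\<close> with \<open>c = L(\<theta>) < \<delta>\<close>. Then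
  \<open>\<bar>\<eta>\<^sup>*\<^sup>n(x)\<bar> \<le> exp (\<theta> * x) * c ^ n\<close> (\<open>prim_le\<close>), so the series converges
  geometrically and its transform is the geometric series for \<open>1 / (s * (\<delta> + L(s)))\<close> at every
  \<open>s \<ge> \<theta>\<close> (\<open>laplace_renewal_sum\<close>). The density \<open>u\<close> and the sum are continuous on
  \<open>(0, \<infinity>)\<close> and have equal Laplace transforms on \<open>[\<theta>, \<infinity>)\<close>, hence they coincide
  (\<open>laplace_transform_eq_zero_imp_eq_zero\<close>).

  Differentiability needs pointwise control of the convolution powers of \<open>\<pi>\<close>, which may be
  singular at \<open>0\<close>. They are continuous on \<open>(0, \<infinity>)\<close> because \<open>\<mu>\<close> has no atoms
  (\<open>continuous_levy_tail\<close>, \<open>continuous_conv\<close>), and monotonicity of \<open>\<pi>\<close> implies that the \<open>n\<close>-th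
  power is at most \<open>n * c ^ n * exp (\<theta> * x) / x\<close> (\<open>times_ker_pow_le\<close>). So the
  differentiated series converges locally uniformly.\<close>

section \<open>Convolution and Laplace transform on the half-line\<close>

definition conv :: "(real \<Rightarrow> ennreal) \<Rightarrow> (real \<Rightarrow> ennreal) \<Rightarrow> real \<Rightarrow> ennreal" where
  "conv f g x = (\<integral>\<^sup>+y. f (x - y) * g y \<partial>lborel)"

definition laplace :: "real \<Rightarrow> (real \<Rightarrow> ennreal) \<Rightarrow> ennreal" where
  "laplace s f = (\<integral>\<^sup>+x. ennreal (exp (- s * x)) * f x \<partial>lborel)"

lemma borel_measurable_conv [measurable]:
  assumes [measurable]: "f \<in> borel_measurable borel" "g \<in> borel_measurable borel"
  shows "conv f g \<in> borel_measurable borel"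
  unfolding conv_def by measurable

lemma nn_integral_lborel_shift:
  fixes f :: "real \<Rightarrow> ennreal"
  assumes [measurable]: "f \<in> borel_measurable borel"
  shows "(\<integral>\<^sup>+x. f (x - t) \<partial>lborel) = (\<integral>\<^sup>+x. f x \<partial>lborel)"
  using nn_integral_real_affine[of "\<lambda>x. f (x - t)" 1 t] by simp

lemma conv_assoc:
  assumes [measurable]: "f \<in> borel_measurable borel" "g \<in> borel_measurable borel"
    "h \<in> borel_measurable borel"
  shows "conv (conv f g) h x = conv f (conv g h) x"
proof -
  have "conv (conv f g) h x
      = (\<integral>\<^sup>+y. (\<integral>\<^sup>+z. f (x - y - z) * g z * h y \<partial>lborel) \<partial>lborel)"
    unfolding conv_def by (simp add: nn_integral_multc)
  also have "\<dots> = (\<integral>\<^sup>+y. (\<integral>\<^sup>+w. f (x - w) * g (w - y) * h y \<partial>lborel) \<partial>lborel)"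
  proof (rule nn_integral_cong)
    fix y
    show "(\<integral>\<^sup>+z. f (x - y - z) * g z * h y \<partial>lborel)
        = (\<integral>\<^sup>+w. f (x - w) * g (w - y) * h y \<partial>lborel)"
      using nn_integral_lborel_shift[of "\<lambda>z. f (x - y - z) * g z * h y" y] by simp
  qed
  also have "\<dots> = (\<integral>\<^sup>+w. (\<integral>\<^sup>+y. f (x - w) * g (w - y) * h y \<partial>lborel) \<partial>lborel)"
    by (rule lborel_pair.Fubini') measurable
  also have "\<dots> = conv f (conv g h) x"
    unfolding conv_def by (simp add: nn_integral_cmult mult.assoc)
  finally show ?thesis .
qed

text \<open>Convolving after multiplication with \<open>exp (- s * x)\<close> is the same as multiplying the
  convolution, because \<open>exp (- s * x) = exp (- s * (x - y)) * exp (- s * y)\<close>. The rest is Fubini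
  and translation invariance; working in \<open>ennreal\<close> removes every integrability question.\<close>

lemma laplace_conv:
  assumes [measurable]: "f \<in> borel_measurable borel" "g \<in> borel_measurable borel"
  shows "laplace s (conv f g) = laplace s f * laplace s g"
proof -
  have "laplace s (conv f g)
      = (\<integral>\<^sup>+x. (\<integral>\<^sup>+y. ennreal (exp (- s * x)) * (f (x - y) * g y) \<partial>lborel) \<partial>lborel)"
    unfolding conv_def laplace_def by (simp add: nn_integral_cmult)
  also have "\<dots> = (\<integral>\<^sup>+y. (\<integral>\<^sup>+x. ennreal (exp (- s * x)) * (f (x - y) * g y) \<partial>lborel) \<partial>lborel)"
    by (rule lborel_pair.Fubini') measurable
  also have "\<dots> = (\<integral>\<^sup>+y. laplace s f * (ennreal (exp (- s * y)) * g y) \<partial>lborel)"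
  proof (rule nn_integral_cong)
    fix y
    have "(\<integral>\<^sup>+x. ennreal (exp (- s * x)) * (f (x - y) * g y) \<partial>lborel)
        = (\<integral>\<^sup>+x. (ennreal (exp (- s * (x - y))) * f (x - y)) * (ennreal (exp (- s * y)) * g y) \<partial>lborel)"
    proof (rule nn_integral_cong)
      fix x
      have "ennreal (exp (- s * x)) = ennreal (exp (- s * (x - y))) * ennreal (exp (- s * y))"
        by (simp add: ennreal_mult'[symmetric] exp_add[symmetric] algebra_simps)
      then show "ennreal (exp (- s * x)) * (f (x - y) * g y)
          = (ennreal (exp (- s * (x - y))) * f (x - y)) * (ennreal (exp (- s * y)) * g y)"
        by (simp only: ac_simps)
    qed
    also have "\<dots> = (\<integral>\<^sup>+x. ennreal (exp (- s * (x - y))) * f (x - y) \<partial>lborel)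
        * (ennreal (exp (- s * y)) * g y)"
      by (rule nn_integral_multc) measurable
    also have "\<dots> = laplace s f * (ennreal (exp (- s * y)) * g y)"
      unfolding laplace_def
      using nn_integral_lborel_shift[of "\<lambda>x. ennreal (exp (- s * x)) * f x" y] by simp
    finally show "(\<integral>\<^sup>+x. ennreal (exp (- s * x)) * (f (x - y) * g y) \<partial>lborel)
        = laplace s f * (ennreal (exp (- s * y)) * g y)" .
  qed
  also have "\<dots> = laplace s f * laplace s g"
    unfolding laplace_def by (simp add: nn_integral_cmult)
  finally show ?thesis .
qed

text \<open>To the left of \<open>x\<close> a function is dominated by a multiple of its own Laplace integrand. So a
  finite Laplace transform implies integrability near \<open>0\<close>.\<close>

lemma le_exp_tilt:
  fixes z :: ennreal
  assumes "0 \<le> \<theta>" "y \<le> x"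
  shows "z \<le> ennreal (exp (\<theta> * x)) * (ennreal (exp (- \<theta> * y)) * z)"
proof -
  have "1 \<le> exp (\<theta> * x) * exp (- \<theta> * y)"
    using assms by (simp add: exp_add[symmetric] mult_left_mono)
  then have "1 \<le> ennreal (exp (\<theta> * x)) * ennreal (exp (- \<theta> * y))"
    by (simp add: ennreal_mult'[symmetric])
  then have "1 * z \<le> ennreal (exp (\<theta> * x)) * ennreal (exp (- \<theta> * y)) * z"
    by (rule mult_right_mono) simp
  then show ?thesis by (simp add: mult.assoc)
qed

lemma conv_supported_halfline:
  assumes "\<And>x. x \<le> 0 \<Longrightarrow> f x = 0" "\<And>x. x \<le> 0 \<Longrightarrow> g x = 0" "x \<le> 0"
  shows "conv f g x = 0"
proof -
  have "f (x - y) * g y = 0" for y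
    using assms by (cases "y \<le> 0") auto
  then have "conv f g x = (\<integral>\<^sup>+y. 0 \<partial>(lborel :: real measure))"
    unfolding conv_def by (intro nn_integral_cong) blast
  then show ?thesis by simp
qed

lemma conv_halfline:
  assumes "\<And>x. x \<le> 0 \<Longrightarrow> f x = 0" "\<And>x. x \<le> 0 \<Longrightarrow> g x = 0"
  shows "conv f g x = (\<integral>\<^sup>+y. f (x - y) * g y * indicator {0<..<x} y \<partial>lborel)"
  unfolding conv_def
  by (rule nn_integral_cong) (use assms in \<open>auto simp: indicator_def not_less\<close>)

text \<open>The part of the convolution over \<open>0 < y < x/2\<close>, where the argument \<open>x - y\<close> of the first factor
  stays away from the possible singularity at \<open>0\<close>.\<close>

definition conv_left :: "(real \<Rightarrow> ennreal) \<Rightarrow> (real \<Rightarrow> ennreal) \<Rightarrow> real \<Rightarrow> ennreal" where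
  "conv_left f g x = (\<integral>\<^sup>+y. f (x - y) * g y * indicator {0<..<x/2} y \<partial>lborel)"

lemma conv_split:
  assumes [measurable]: "f \<in> borel_measurable borel" "g \<in> borel_measurable borel"
    and f0: "\<And>x. x \<le> 0 \<Longrightarrow> f x = 0" and g0: "\<And>x. x \<le> 0 \<Longrightarrow> g x = 0"
  shows "conv f g x = conv_left f g x + conv_left g f x"
proof -
  have *: "conv f g x = (\<integral>\<^sup>+y. f (x - y) * g y * indicator {0<..<x} y \<partial>lborel)"
    by (rule conv_halfline) (use f0 g0 in auto)
  have "conv f g x = (\<integral>\<^sup>+y. f (x - y) * g y * indicator {0<..<x/2} y
      + f (x - y) * g y * indicator {x/2<..<x} y \<partial>lborel)"
    unfolding *
    using AE_lborel_singleton[of "x/2"]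
    by (intro nn_integral_cong_AE, eventually_elim) (auto simp: indicator_def)
  also have "\<dots> = conv_left f g x + (\<integral>\<^sup>+y. f (x - y) * g y * indicator {x/2<..<x} y \<partial>lborel)"
    unfolding conv_left_def by (rule nn_integral_add) measurable
  also have "(\<integral>\<^sup>+y. f (x - y) * g y * indicator {x/2<..<x} y \<partial>lborel)
      = (\<integral>\<^sup>+y. f y * g (x - y) * indicator {x/2<..<x} (x - y) \<partial>lborel)"
    using nn_integral_real_affine[of "\<lambda>y. f (x - y) * g y * indicator {x/2<..<x} y" "-1" x]
    by simp
  also have "\<dots> = conv_left g f x"
    unfolding conv_left_def
    by (rule nn_integral_cong) (auto simp: indicator_def mult.commute)
  finally show ?thesis .
qed

text \<open>For the limit at \<open>x\<close> only values of \<open>f\<close> on the compact interval \<open>[x/4, 2x]\<close> enter, so \<open>f\<close>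
  may be replaced by its maximum there, and a multiple of the tilted \<open>g\<close> is an integrable majorant.
  The moving end point \<open>x/2\<close> of the domain only matters on the null set \<open>{x/2}\<close>.\<close>

lemma continuous_conv_left:
  assumes [measurable]: "f \<in> borel_measurable borel" "g \<in> borel_measurable borel"
    and f: "continuous_on {0<..} f" "\<And>x. f x < \<infinity>"
    and g: "\<And>x. g x < \<infinity>" "laplace \<theta> g < \<infinity>" and "0 \<le> \<theta>"
  shows "continuous_on {0<..} (conv_left f g)"
proof -
  have "(\<lambda>n. conv_left f g (X n)) \<longlonglongrightarrow> conv_left f g x" if x: "x > 0" and X: "X \<longlonglongrightarrow> x" for X x
  proof -
    have "continuous_on {x/4..2*x} f"
      using x by (intro continuous_on_subset[OF f(1)]) auto
    moreover have "{x/4..2*x} \<noteq> {}"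
      using x by auto
    ultimately have "\<exists>z\<in>{x/4..2*x}. \<forall>y\<in>{x/4..2*x}. f y \<le> f z"
      by (intro continuous_attains_sup) auto
    then obtain z where z: "\<And>y. y \<in> {x/4..2*x} \<Longrightarrow> f y \<le> f z"
      by blast
    define w where "w y = f z * ennreal (exp (\<theta> * x)) * (ennreal (exp (- \<theta> * y)) * g y)" for y
    have [measurable]: "w \<in> borel_measurable borel"
      unfolding w_def by measurable
    have "(\<integral>\<^sup>+y. w y \<partial>lborel) = f z * ennreal (exp (\<theta> * x)) * laplace \<theta> g"
      unfolding w_def laplace_def by (simp add: nn_integral_cmult)
    then have w_fin: "(\<integral>\<^sup>+y. w y \<partial>lborel) < \<infinity>"
      using f(2)[of z] g(2) by (simp add: ennreal_mult_less_top)
    have "eventually (\<lambda>n. X n \<in> {x/2<..<2*x}) sequentially"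
      using X x by (intro topological_tendstoD[OF X]) auto
    then obtain N where N: "\<And>n. n \<ge> N \<Longrightarrow> X n \<in> {x/2<..<2*x}"
      by (auto simp: eventually_sequentially)
    define h where "h n y = f (X (n + N) - y) * g y * indicator {0<..<X (n + N)/2} y" for n y
    have "(\<lambda>n. \<integral>\<^sup>+y. h n y \<partial>lborel) \<longlonglongrightarrow> conv_left f g x"
      unfolding conv_left_def
    proof (rule nn_integral_dominated_convergence[where w = w])
      show "AE y in lborel. h n y \<le> w y" for n
      proof (rule AE_I2)
        fix y
        show "h n y \<le> w y"
        proof (cases "y \<in> {0<..<X (n + N)/2}")
          case True
          then have y: "X (n + N) - y \<in> {x/4..2*x}" "y \<le> x"
            using N[of "n + N"] by auto
          have "g y \<le> ennreal (exp (\<theta> * x)) * (ennreal (exp (- \<theta> * y)) * g y)"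
            using \<open>0 \<le> \<theta>\<close> y(2) by (rule le_exp_tilt)
          then show ?thesis
            using mult_mono[OF z[OF y(1)]] True by (simp add: h_def w_def mult.assoc)
        qed (simp add: h_def)
      qed
      show "AE y in lborel. (\<lambda>n. h n y) \<longlonglongrightarrow> f (x - y) * g y * indicator {0<..<x/2} y"
      proof (rule AE_mp[OF AE_lborel_singleton[of "x/2"]], rule AE_I2, rule impI)
        fix y assume "y \<noteq> x/2"
        have XN: "(\<lambda>n. X (n + N)) \<longlonglongrightarrow> x"
          using X by (rule LIMSEQ_ignore_initial_segment)
        consider "y \<le> 0" | "0 < y" "y < x/2" | "y > x/2"
          using \<open>y \<noteq> x/2\<close> by linarith
        then show "(\<lambda>n. h n y) \<longlonglongrightarrow> f (x - y) * g y * indicator {0<..<x/2} y"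
        proof cases
          case 2
          have "eventually (\<lambda>n. X (n + N) > 2 * y) sequentially"
            using 2 by (intro order_tendstoD(1)[OF XN]) auto
          then have ev: "eventually (\<lambda>n. g y * f (X (n + N) - y) = h n y) sequentially"
            by eventually_elim (use 2 in \<open>auto simp: h_def mult.commute\<close>)
          have "isCont f (x - y)"
            using 2 continuous_on_eq_continuous_at[of "{0<..}" f] f(1) by auto
          then have "(\<lambda>n. f (X (n + N) - y)) \<longlonglongrightarrow> f (x - y)"
            by (rule isCont_tendsto_compose) (intro tendsto_intros XN)
          then have "(\<lambda>n. g y * f (X (n + N) - y)) \<longlonglongrightarrow> g y * f (x - y)"
            using g(1) by (intro ennreal_tendsto_cmult) auto
          then show ?thesis
            using 2 by (simp add: mult.commute filterlim_cong[OF refl refl ev])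
        next
          case 3
          have "eventually (\<lambda>n. X (n + N) < 2 * y) sequentially"
            using 3 by (intro order_tendstoD(2)[OF XN]) auto
          then have "eventually (\<lambda>n. h n y = 0) sequentially"
            by eventually_elim (use 3 in \<open>auto simp: h_def\<close>)
          then show ?thesis
            using 3 by (simp add: tendsto_eventually)
        qed (auto simp: h_def)
      qed
    qed (use w_fin in \<open>auto simp: h_def\<close>)
    then have "(\<lambda>n. conv_left f g (X (n + N))) \<longlonglongrightarrow> conv_left f g x"
      by (simp add: h_def conv_left_def)
    then show ?thesis
      by (rule LIMSEQ_offset)
  qed
  then have "isCont (conv_left f g) x" if "x > 0" for x
    using that by (auto simp: continuous_at_sequentially o_def)
  then show ?thesis
    by (auto intro: continuous_at_imp_continuous_on)
qed

text \<open>Both factors may blow up at \<open>0\<close>, so the integrand has singularities at both ends of \<open>(0, x)\<close>.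
  Cutting at \<open>x/2\<close> separates them.\<close>

lemma continuous_conv:
  assumes [measurable]: "f \<in> borel_measurable borel" "g \<in> borel_measurable borel"
    and f: "\<And>x. x \<le> 0 \<Longrightarrow> f x = 0" "continuous_on {0<..} f" "\<And>x. f x < \<infinity>" "laplace \<theta> f < \<infinity>"
    and g: "\<And>x. x \<le> 0 \<Longrightarrow> g x = 0" "continuous_on {0<..} g" "\<And>x. g x < \<infinity>" "laplace \<theta> g < \<infinity>"
    and "0 \<le> \<theta>"
  shows "continuous_on {0<..} (conv f g)"
proof -
  have "conv f g = (\<lambda>x. conv_left f g x + conv_left g f x)"
    using conv_split[of f g] f(1) g(1) by auto
  then show ?thesis
    using continuous_conv_left[of f g \<theta>] continuous_conv_left[of g f \<theta>] f g \<open>0 \<le> \<theta>\<close>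
    by (auto intro!: continuous_on_add_ennreal)
qed

primrec conv_pow :: "(real \<Rightarrow> ennreal) \<Rightarrow> (real \<Rightarrow> ennreal) \<Rightarrow> nat \<Rightarrow> real \<Rightarrow> ennreal" where
  "conv_pow f k 0 = f"
| "conv_pow f k (Suc n) = conv (conv_pow f k n) k"

lemma borel_measurable_conv_pow [measurable]:
  assumes [measurable]: "f \<in> borel_measurable borel" "k \<in> borel_measurable borel"
  shows "conv_pow f k n \<in> borel_measurable borel"
  by (induction n) auto

text \<open>By associativity the factor \<open>f\<close> can be split off. For \<open>f = indicator {0<..}\<close> this exhibits
  \<open>conv_pow f k (Suc n)\<close> as the primitive of a convolution power of \<open>k\<close>.\<close>

lemma conv_pow_Suc_left:
  assumes [measurable]: "f \<in> borel_measurable borel" "k \<in> borel_measurable borel"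
  shows "conv_pow f k (Suc n) x = conv f (conv_pow k k n) x"
proof (induction n arbitrary: x)
  case (Suc n)
  have "conv_pow f k (Suc (Suc n)) x = conv (conv_pow f k (Suc n)) k x"
    by simp
  also have "\<dots> = conv (conv f (conv_pow k k n)) k x"
    by (subst conv_def, subst conv_def) (simp only: Suc.IH)
  also have "\<dots> = conv f (conv_pow k k (Suc n)) x"
    by (simp add: conv_assoc)
  finally show ?case .
qed simp

lemma laplace_conv_pow:
  assumes [measurable]: "f \<in> borel_measurable borel" "k \<in> borel_measurable borel"
  shows "laplace s (conv_pow f k n) = laplace s f * laplace s k ^ n"
  by (induction n) (simp_all add: laplace_conv mult_ac)

lemma conv_pow_supported_halfline:
  assumes "\<And>x. x \<le> 0 \<Longrightarrow> f x = 0" "\<And>x. x \<le> 0 \<Longrightarrow> k x = 0" "x \<le> 0"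
  shows "conv_pow f k n x = 0"
  using assms by (induction n arbitrary: x) (auto intro!: conv_supported_halfline)

lemma laplace_indicator_halfline:
  assumes "s > 0"
  shows "laplace s (indicator {0<..}) = ennreal (1 / s)"
proof -
  have "laplace s (indicator {0<..}) = (\<integral>\<^sup>+x. ennreal (exp (- s * x)) * indicator {0..} x \<partial>lborel)"
    unfolding laplace_def using AE_lborel_singleton[of 0]
    by (intro nn_integral_cong_AE, eventually_elim) (auto simp: indicator_def)
  also have "\<dots> = ennreal (0 - (- exp (- s * 0) / s))"
  proof (rule nn_integral_FTC_atLeast[where F = "\<lambda>x. - exp (- s * x) / s"])
    show "((\<lambda>x. - exp (- s * x) / s) \<longlongrightarrow> 0) at_top"
      using assms by real_asymp
  qed (use assms in \<open>auto intro!: derivative_eq_intros\<close>)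
  finally show ?thesis by simp
qed

lemma nn_integral_exp_Ioo:
  assumes "0 < s" "0 < x"
  shows "(\<integral>\<^sup>+y. ennreal (exp (- s * y)) * indicator {0<..<x} y \<partial>lborel) = ennreal ((1 - exp (- s * x)) / s)"
proof -
  have "(\<integral>\<^sup>+y. ennreal (exp (- s * y)) * indicator {0<..<x} y \<partial>lborel)
      = (\<integral>\<^sup>+y. ennreal (exp (- s * y)) * indicator {0..x} y \<partial>lborel)"
    using AE_lborel_singleton[of 0] AE_lborel_singleton[of x]
    by (intro nn_integral_cong_AE, eventually_elim) (auto simp: indicator_def)
  also have "\<dots> = ennreal (- exp (- s * x) / s - (- exp (- s * 0) / s))"
    by (rule nn_integral_FTC_Icc[where F = "\<lambda>x. - exp (- s * x) / s"])
      (use assms in \<open>auto intro!: derivative_eq_intros\<close>)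
  also have "- exp (- s * x) / s - (- exp (- s * 0) / s) = (1 - exp (- s * x)) / s"
    by (simp add: diff_divide_distrib)
  finally show ?thesis .
qed

lemma conv_indicator_halfline:
  assumes [measurable]: "f \<in> borel_measurable borel" and f0: "\<And>x. x \<le> 0 \<Longrightarrow> f x = 0"
  shows "conv (indicator {0<..}) f x = (\<integral>\<^sup>+y. f y * indicator {0<..<x} y \<partial>lborel)"
  unfolding conv_def
  by (rule nn_integral_cong) (use f0 in \<open>auto simp: indicator_def not_less\<close>)

lemma conv_indicator_le_laplace:
  assumes [measurable]: "f \<in> borel_measurable borel" and f0: "\<And>x. x \<le> 0 \<Longrightarrow> f x = 0" and "0 \<le> \<theta>"
  shows "conv (indicator {0<..}) f x \<le> ennreal (exp (\<theta> * x)) * laplace \<theta> f"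
proof -
  have "conv (indicator {0<..}) f x
      \<le> (\<integral>\<^sup>+y. ennreal (exp (\<theta> * x)) * (ennreal (exp (- \<theta> * y)) * f y) \<partial>lborel)"
    unfolding conv_indicator_halfline[of f, OF assms(1) f0, simplified]
  proof (rule nn_integral_mono)
    fix y
    show "f y * indicator {0<..<x} y \<le> ennreal (exp (\<theta> * x)) * (ennreal (exp (- \<theta> * y)) * f y)"
    proof (cases "y \<in> {0<..<x}")
      case True
      then show ?thesis
        using le_exp_tilt[OF \<open>0 \<le> \<theta>\<close>, of y x "f y"] by simp
    qed simp
  qed
  also have "\<dots> = ennreal (exp (\<theta> * x)) * laplace \<theta> f"
    unfolding laplace_def by (rule nn_integral_cmult) measurable
  finally show ?thesis .
qed

section \<open>Uniqueness of the Laplace transform\<close>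

text \<open>Lerch's uniqueness theorem for continuous functions, from the values of the transform on an
  arithmetic progression. In the variable \<open>z = exp (- x)\<close> the hypothesis says that all moments of
  \<open>W x = exp (- s * x) * w x\<close> vanish. By Weierstrass, \<open>W\<close> is then orthogonal to all
  continuous functions of \<open>z\<close>, and a bump near a point where \<open>w\<close> does not vanish gives a
  contradiction.\<close>

lemma laplace_transform_eq_zero_imp_eq_zero:
  fixes w :: "real \<Rightarrow> real"
  assumes cont: "continuous_on {0<..} w"
    and int: "integrable lborel (\<lambda>x. indicator {0<..} x * (exp (- s * x) * w x))"
    and zero: "\<And>n. (LINT x|lborel. indicator {0<..} x * (exp (- (s + real n) * x) * w x)) = 0"
    and "x0 > 0"
  shows "w x0 = 0"
proof (rule ccontr)
  assume "w x0 \<noteq> 0"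
  define W where "W = (\<lambda>x. indicator {0<..} x * (exp (- s * x) * w x))"
  have W: "integrable lborel W"
    using int by (simp add: W_def)
  then have [measurable]: "W \<in> borel_measurable borel"
    by auto
  have intW: "integrable lborel (\<lambda>x. g (exp (- x)) * W x)" if g: "continuous_on UNIV g" for g :: "real \<Rightarrow> real"
  proof -
    have [measurable]: "g \<in> borel_measurable borel"
      using g by (rule borel_measurable_continuous_onI)
    have "bounded (g ` {0..1})"
      using g by (intro compact_imp_bounded compact_continuous_image) (auto intro: continuous_on_subset)
    then obtain b where b: "\<And>z. z \<in> {0..1} \<Longrightarrow> \<bar>g z\<bar> \<le> b"
      unfolding bounded_iff by (metis imageI real_norm_def)
    show ?thesis
    proof (rule Bochner_Integration.integrable_bound[where f = "\<lambda>x. b * W x"])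
      show "AE x in lborel. norm (g (exp (- x)) * W x) \<le> norm (b * W x)"
      proof (rule AE_I2)
        fix x :: real
        have "\<bar>g (exp (- x))\<bar> \<le> \<bar>b\<bar>" if "x > 0"
          using b[of "exp (- x)"] that by auto
        then show "norm (g (exp (- x)) * W x) \<le> norm (b * W x)"
          by (cases "x > 0") (auto simp: abs_mult W_def intro!: mult_right_mono)
      qed
    qed (use W in auto)
  qed
  have poly0: "(LINT x|lborel. p (exp (- x)) * W x) = 0"
    if poly: "real_polynomial_function p" for p :: "real \<Rightarrow> real"
  proof -
    obtain a n where p: "p = (\<lambda>x. \<Sum>i\<le>n. a i * x ^ i)"
      using poly unfolding real_polynomial_function_iff_sum by blast
    have int_i: "integrable lborel (\<lambda>x. exp (- x) ^ i * W x)" for i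
      by (rule intW[of "\<lambda>z. z ^ i"]) (intro continuous_intros)
    have "(LINT x|lborel. p (exp (- x)) * W x) = (LINT x|lborel. (\<Sum>i\<le>n. a i * (exp (- x) ^ i * W x)))"
      by (simp add: p sum_distrib_right mult.assoc)
    also have "\<dots> = (\<Sum>i\<le>n. a i * (LINT x|lborel. exp (- x) ^ i * W x))"
      using int_i by (simp add: Bochner_Integration.integral_sum)
    also have "\<dots> = 0"
    proof (rule sum.neutral, rule ballI)
      fix i
      have "exp (- x) ^ i * W x = indicator {0<..} x * (exp (- (s + real i) * x) * w x)" for x
        by (simp add: W_def exp_of_nat_mult[symmetric] exp_add[symmetric] algebra_simps indicator_def)
      then show "a i * (LINT x|lborel. exp (- x) ^ i * W x) = 0"
        using zero[of i] by simp
    qed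
    finally show ?thesis .
  qed
  have cont0: "(LINT x|lborel. g (exp (- x)) * W x) = 0"
    if g: "continuous_on UNIV g" for g :: "real \<Rightarrow> real"
  proof -
    let ?I = "LINT x|lborel. g (exp (- x)) * W x" and ?K = "LINT x|lborel. \<bar>W x\<bar>"
    have "\<bar>?I\<bar> \<le> e * ?K" if "e > 0" for e
    proof -
      obtain p where p: "real_polynomial_function p" "\<And>z. z \<in> {0..1} \<Longrightarrow> \<bar>g z - p z\<bar> < e"
        using Stone_Weierstrass_real_polynomial_function[of "{0..1::real}" g e] g \<open>e > 0\<close>
        by (metis compact_Icc continuous_on_subset subset_UNIV)
      have cp: "continuous_on UNIV p"
        using p(1) by (simp add: continuous_on_polymonial_function real_polynomial_function_eq)
      have "?I = (LINT x|lborel. g (exp (- x)) * W x) - (LINT x|lborel. p (exp (- x)) * W x)"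
        using poly0[OF p(1)] by simp
      also have "\<dots> = (LINT x|lborel. g (exp (- x)) * W x - p (exp (- x)) * W x)"
        using intW[OF g] intW[OF cp] by simp
      finally have "\<bar>?I\<bar> \<le> (LINT x|lborel. \<bar>g (exp (- x)) * W x - p (exp (- x)) * W x\<bar>)"
        by simp
      also have "\<dots> \<le> (LINT x|lborel. e * \<bar>W x\<bar>)"
      proof (rule integral_mono)
        fix x :: real
        have "\<bar>g (exp (- x)) - p (exp (- x))\<bar> \<le> e" if "x > 0"
          using p(2)[of "exp (- x)"] that by auto
        then have "\<bar>(g (exp (- x)) - p (exp (- x))) * W x\<bar> \<le> e * \<bar>W x\<bar>"
          by (cases "x > 0") (auto simp: abs_mult W_def intro!: mult_right_mono)
        then show "\<bar>g (exp (- x)) * W x - p (exp (- x)) * W x\<bar> \<le> e * \<bar>W x\<bar>"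
          by (simp add: algebra_simps)
      qed (use intW[OF g] intW[OF cp] W in auto)
      finally show ?thesis
        using W by simp
    qed
    note * = this
    define K where "K = ?K"
    have K: "K \<ge> 0" by (simp add: K_def)
    show ?thesis
    proof (rule ccontr)
      assume "?I \<noteq> 0"
      then have "\<bar>?I\<bar> / (2 * (K + 1)) > 0"
        using K by simp
      from *[OF this, folded K_def] have "\<bar>?I\<bar> * (2 * (K + 1)) \<le> \<bar>?I\<bar> * K"
        using K by (simp add: field_simps)
      then have "2 * (K + 1) \<le> K"
        using \<open>?I \<noteq> 0\<close> by (simp add: mult_le_cancel_left)
      then show False using K by simp
    qed
  qed
  define \<sigma> where "\<sigma> = sgn (w x0)"
  have "isCont (\<lambda>x. \<sigma> * w x) x0"
    using cont \<open>x0 > 0\<close> by (auto simp: continuous_on_eq_continuous_at intro: continuous_intros)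
  moreover have "\<sigma> * w x0 > 0"
    using \<open>w x0 \<noteq> 0\<close> by (simp add: \<sigma>_def sgn_if)
  ultimately have "eventually (\<lambda>x. \<sigma> * w x > 0) (nhds x0)"
    unfolding eventually_nhds_conv_at by (auto simp: isCont_def intro: order_tendstoD(1))
  moreover have "eventually (\<lambda>x. x > 0) (nhds x0)"
    using \<open>x0 > 0\<close> eventually_nhds_in_open[of "{0<..}" x0] by simp
  ultimately have "eventually (\<lambda>x. x > 0 \<and> \<sigma> * w x > 0) (nhds x0)"
    by eventually_elim auto
  then obtain r where r: "r > 0" "\<And>x. dist x x0 < r \<Longrightarrow> x > 0 \<and> \<sigma> * w x > 0"
    unfolding eventually_nhds_metric by blast
  \<comment> \<open>As a function of \<open>x\<close>, with \<open>z = exp (- x)\<close>, this bump is supported on \<open>(x0 - r, x0 + r)\<close>.\<close>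
  define g where "g z = \<sigma> * (max 0 (z - exp (- (x0 + r))) * max 0 (exp (- (x0 - r)) - z))" for z
  have cg: "continuous_on UNIV g"
    unfolding g_def by (intro continuous_intros)
  have pos: "g (exp (- x)) * W x > 0" if "x \<in> {x0 - r<..<x0 + r}" for x
  proof -
    have "x > 0" "\<sigma> * w x > 0"
      using r(2)[of x] that by (auto simp: dist_real_def)
    moreover have "g (exp (- x)) * W x
        = (exp (- x) - exp (- (x0 + r))) * (exp (- (x0 - r)) - exp (- x)) * exp (- s * x) * (\<sigma> * w x)"
      using that \<open>x > 0\<close> by (simp add: g_def W_def)
    ultimately show ?thesis
      using that by simp
  qed
  moreover have "g (exp (- x)) * W x = 0" if "x \<notin> {x0 - r<..<x0 + r}" for x
    using that by (auto simp: g_def not_less max_def)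
  ultimately have "AE x in lborel. 0 \<le> g (exp (- x)) * W x"
    by (intro AE_I2) (metis less_imp_le order_refl)
  then have "AE x in lborel. g (exp (- x)) * W x = 0"
    using integral_nonneg_eq_0_iff_AE[OF intW[OF cg]] cont0[OF cg] by simp
  then have "AE x in lborel. x \<notin> {x0 - r<..<x0 + r}"
    by eventually_elim (use pos in force)
  then have "emeasure lborel {x0 - r<..<x0 + r} = 0"
    by (subst (asm) AE_iff_null_sets[symmetric]) auto
  then show False
    using r(1) by simp
qed

section \<open>Convolution powers of a decreasing kernel\<close>

text \<open>The abstract form of the tail \<open>levy_tail q \<mu>\<close>: a decreasing continuous function on
  \<open>(0, \<infinity>)\<close>, possibly unbounded at \<open>0\<close>, whose Laplace transform at some \<open>\<theta>\<close> is \<open>c\<close>.\<close>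

locale decreasing_kernel =
  fixes a :: "real \<Rightarrow> real" and \<theta> c :: real
  assumes measurable_a [measurable]: "a \<in> borel_measurable borel"
    and nonneg: "\<And>x. 0 \<le> a x"
    and antimono: "\<And>x y. 0 < x \<Longrightarrow> x \<le> y \<Longrightarrow> a y \<le> a x"
    and cont: "continuous_on {0<..} a"
    and \<theta>_pos: "0 < \<theta>" and c_nonneg: "0 \<le> c"
    and laplace_c: "laplace \<theta> (\<lambda>x. indicator {0<..} x * ennreal (a x)) = ennreal c"
begin

definition ker :: "real \<Rightarrow> ennreal" where
  "ker x = indicator {0<..} x * ennreal (a x)"

text \<open>\<open>ker_pow n\<close> is the convolution power of exponent \<open>n + 1\<close>; the power of exponent \<open>0\<close> would be a
  point mass.\<close>

definition ker_pow :: "nat \<Rightarrow> real \<Rightarrow> ennreal" where "ker_pow = conv_pow ker ker"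

text \<open>\<open>prim (Suc n)\<close> is the primitive of \<open>ker_pow n\<close>; up to sign, \<open>prim n\<close> is \<open>\<eta>\<^sup>*\<^sup>n\<close>.\<close>

definition prim :: "nat \<Rightarrow> real \<Rightarrow> ennreal" where "prim = conv_pow (indicator {0<..}) ker"

lemma ker_measurable [measurable]: "ker \<in> borel_measurable borel"
  unfolding ker_def by measurable

lemma ker_pow_measurable [measurable]: "ker_pow n \<in> borel_measurable borel"
  unfolding ker_pow_def by measurable

lemma prim_measurable [measurable]: "prim n \<in> borel_measurable borel"
  unfolding prim_def by measurable

lemma ker_pow_Suc: "ker_pow (Suc n) = conv (ker_pow n) ker"
  by (simp add: ker_pow_def)

lemma ker_halfline: "x \<le> 0 \<Longrightarrow> ker x = 0"
  by (simp add: ker_def)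

lemma ker_pow_halfline: "x \<le> 0 \<Longrightarrow> ker_pow n x = 0"
  unfolding ker_pow_def by (rule conv_pow_supported_halfline) (auto simp: ker_halfline)

lemma prim_halfline: "x \<le> 0 \<Longrightarrow> prim n x = 0"
  unfolding prim_def by (rule conv_pow_supported_halfline) (auto simp: ker_halfline)

lemma laplace_ker: "laplace \<theta> ker = ennreal c"
  using laplace_c by (simp add: ker_def[abs_def])

lemma laplace_ker_pow: "laplace \<theta> (ker_pow n) = ennreal (c ^ Suc n)"
  unfolding ker_pow_def using c_nonneg
  by (simp add: laplace_conv_pow laplace_ker ennreal_power ennreal_mult)

lemma laplace_prim: "s > 0 \<Longrightarrow> laplace s (prim n) = ennreal (1 / s) * laplace s ker ^ n"
  unfolding prim_def by (simp add: laplace_conv_pow laplace_indicator_halfline)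

lemma prim_Suc: "prim (Suc n) x = conv (indicator {0<..}) (ker_pow n) x"
  unfolding prim_def ker_pow_def by (rule conv_pow_Suc_left) measurable

text \<open>The Laplace transform at \<open>\<theta>\<close> is multiplicative, so the mass of the \<open>n\<close>-th power on \<open>(0, x)\<close>
  is at most \<open>exp (\<theta> * x) * c ^ n\<close>. For \<open>c < \<delta>\<close> this gives geometric convergence.\<close>

lemma prim_le: "prim n x \<le> ennreal (exp (\<theta> * x) * c ^ n)"
proof (cases n)
  case 0
  have "(indicator {0<..} x :: ennreal) \<le> ennreal (exp (\<theta> * x))"
    using \<theta>_pos by (auto simp: indicator_def)
  then show ?thesis using 0 by (simp add: prim_def)
next
  case (Suc m)
  have "prim n x \<le> ennreal (exp (\<theta> * x)) * laplace \<theta> (ker_pow m)"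
    unfolding Suc prim_Suc using \<theta>_pos by (intro conv_indicator_le_laplace) (auto simp: ker_pow_halfline)
  then show ?thesis
    using Suc c_nonneg by (simp add: laplace_ker_pow ennreal_mult'[symmetric])
qed

text \<open>A decreasing function satisfies \<open>y * f y \<le> \<integral> f\<close> over \<open>(0, y)\<close>; apply this to
  \<open>exp (- \<theta> * y) * ker y\<close>.\<close>

lemma times_ker_le: "ennreal y * ker y \<le> ennreal (exp (\<theta> * y) * c)"
proof (cases "y > 0")
  case True
  have "ennreal y * (ennreal (exp (- \<theta> * y)) * ker y)
      = (\<integral>\<^sup>+z. ennreal (exp (- \<theta> * y)) * ker y * indicator {0<..<y} z \<partial>lborel)"
    using True by (subst nn_integral_cmult_indicator) (auto simp: mult.commute)
  also have "\<dots> \<le> laplace \<theta> ker"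
    unfolding laplace_def
  proof (rule nn_integral_mono)
    fix z
    have "exp (- \<theta> * y) \<le> exp (- \<theta> * z)" "a y \<le> a z" if "z \<in> {0<..<y}"
      using that antimono[of z y] \<theta>_pos by auto
    then show "ennreal (exp (- \<theta> * y)) * ker y * indicator {0<..<y} z \<le> ennreal (exp (- \<theta> * z)) * ker z"
      using True by (cases "z \<in> {0<..<y}") (auto simp: ker_def intro!: mult_mono ennreal_leI)
  qed
  finally have "ennreal y * (ennreal (exp (- \<theta> * y)) * ker y) \<le> ennreal c"
    by (simp add: laplace_ker)
  then have "ennreal (exp (\<theta> * y)) * (ennreal y * (ennreal (exp (- \<theta> * y)) * ker y))
      \<le> ennreal (exp (\<theta> * y)) * ennreal c"
    by (rule mult_left_mono) simp
  moreover have "ennreal (exp (\<theta> * y)) * (ennreal y * (ennreal (exp (- \<theta> * y)) * ker y)) = ennreal y * ker y"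
    using True nonneg[of y]
    by (simp add: ker_def ennreal_mult'[symmetric] ennreal_mult''[symmetric] exp_minus)
  ultimately show ?thesis
    using c_nonneg by (simp add: ennreal_mult'')
qed (simp add: ker_halfline)

text \<open>A pointwise bound on the convolution powers, which mere integrability of the kernel does not
  give. Multiplication with \<open>x\<close> is a derivation of the convolution product, because
  \<open>x = (x - y) + y\<close>. So each step produces one term in which the weight falls on the old power
  (induction hypothesis) and one in which it falls on the new factor \<open>ker\<close>, which is then bounded.
  The linear factor \<open>Suc n\<close> does not spoil geometric convergence.\<close>

lemma times_ker_pow_le: "ennreal x * ker_pow n x \<le> ennreal (real (Suc n) * c ^ Suc n * exp (\<theta> * x))"
proof (induction n arbitrary: x)
  case 0
  then show ?case using times_ker_le[of x] by (simp add: ker_pow_def mult.commute)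
next
  case (Suc n)
  let ?A = "real (Suc n) * c ^ Suc n"
  have A: "0 \<le> ?A" using c_nonneg by simp
  have "ennreal x * ker_pow (Suc n) x = (\<integral>\<^sup>+y. ennreal x * (ker_pow n (x - y) * ker y) \<partial>lborel)"
    unfolding ker_pow_Suc conv_def by (rule nn_integral_cmult[symmetric]) measurable
  also have "\<dots> \<le> (\<integral>\<^sup>+y. ennreal (exp (\<theta> * x) * ?A) * (ennreal (exp (- \<theta> * y)) * ker y)
      + ennreal (exp (\<theta> * x) * c) * (ennreal (exp (- \<theta> * (x - y))) * ker_pow n (x - y)) \<partial>lborel)"
  proof (rule nn_integral_mono)
    fix y
    show "ennreal x * (ker_pow n (x - y) * ker y)
      \<le> ennreal (exp (\<theta> * x) * ?A) * (ennreal (exp (- \<theta> * y)) * ker y)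
      + ennreal (exp (\<theta> * x) * c) * (ennreal (exp (- \<theta> * (x - y))) * ker_pow n (x - y))"
    proof (cases "0 < y \<and> y < x")
      case True
      have "ennreal x = ennreal (x - y) + ennreal y"
        using True by (simp add: ennreal_plus[symmetric] del: ennreal_plus)
      then have "ennreal x * (ker_pow n (x - y) * ker y)
          = (ennreal (x - y) * ker_pow n (x - y)) * ker y + (ennreal y * ker y) * ker_pow n (x - y)"
        by (simp add: distrib_left distrib_right mult_ac)
      also have "\<dots> \<le> ennreal (?A * exp (\<theta> * (x - y))) * ker y + ennreal (exp (\<theta> * y) * c) * ker_pow n (x - y)"
        by (intro add_mono mult_right_mono Suc.IH times_ker_le) auto
      also have "?A * exp (\<theta> * (x - y)) = (exp (\<theta> * x) * ?A) * exp (- \<theta> * y)"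
        by (simp add: exp_add[symmetric] algebra_simps exp_diff exp_minus field_simps)
      also have "exp (\<theta> * y) * c = (exp (\<theta> * x) * c) * exp (- \<theta> * (x - y))"
        by (simp add: exp_add[symmetric] algebra_simps exp_diff exp_minus field_simps)
      also have "ennreal (exp (\<theta> * x) * ?A * exp (- \<theta> * y))
          = ennreal (exp (\<theta> * x) * ?A) * ennreal (exp (- \<theta> * y))"
        by (rule ennreal_mult'') simp
      also have "ennreal (exp (\<theta> * x) * c * exp (- \<theta> * (x - y)))
          = ennreal (exp (\<theta> * x) * c) * ennreal (exp (- \<theta> * (x - y)))"
        by (rule ennreal_mult'') simp
      finally show ?thesis
        by (simp only: mult.assoc[where 'a = ennreal])
    next
      case False
      then have "ker_pow n (x - y) * ker y = 0"
        by (auto simp: ker_pow_halfline ker_halfline not_less)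
      then show ?thesis by (simp only:) simp
    qed
  qed
  also have "\<dots> = ennreal (exp (\<theta> * x) * ?A) * laplace \<theta> ker
      + ennreal (exp (\<theta> * x) * c) * (\<integral>\<^sup>+y. ennreal (exp (- \<theta> * (x - y))) * ker_pow n (x - y) \<partial>lborel)"
    unfolding laplace_def
    by (subst nn_integral_add, measurable, subst nn_integral_cmult, measurable,
        subst nn_integral_cmult, measurable)
  also have "(\<integral>\<^sup>+y. ennreal (exp (- \<theta> * (x - y))) * ker_pow n (x - y) \<partial>lborel) = laplace \<theta> (ker_pow n)"
    using nn_integral_real_affine[of "\<lambda>y. ennreal (exp (- \<theta> * (x - y))) * ker_pow n (x - y)" "-1" x]
    by (simp add: laplace_def)
  also have "ennreal (exp (\<theta> * x) * ?A) * laplace \<theta> ker + ennreal (exp (\<theta> * x) * c) * laplace \<theta> (ker_pow n)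
      = ennreal (exp (\<theta> * x) * ?A * c + exp (\<theta> * x) * c * c ^ Suc n)"
    unfolding laplace_ker laplace_ker_pow using A c_nonneg
    by (simp add: ennreal_mult'[symmetric] ennreal_plus[symmetric] del: ennreal_plus power_Suc of_nat_Suc)
  also have "exp (\<theta> * x) * ?A * c + exp (\<theta> * x) * c * c ^ Suc n
      = real (Suc (Suc n)) * c ^ Suc (Suc n) * exp (\<theta> * x)"
    by (simp add: algebra_simps)
  finally show ?case .
qed

lemma ker_pow_le:
  assumes "x > 0"
  shows "ker_pow n x \<le> ennreal (real (Suc n) * c ^ Suc n * exp (\<theta> * x) / x)"
proof -
  have "ennreal (1 / x) * (ennreal x * ker_pow n x)
      \<le> ennreal (1 / x) * ennreal (real (Suc n) * c ^ Suc n * exp (\<theta> * x))"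
    by (intro mult_left_mono times_ker_pow_le) auto
  moreover have "ennreal (1 / x) * (ennreal x * ker_pow n x) = ker_pow n x"
    using assms by (simp add: mult.assoc[symmetric] ennreal_mult'[symmetric])
  moreover have "ennreal (1 / x) * ennreal (real (Suc n) * c ^ Suc n * exp (\<theta> * x))
      = ennreal (real (Suc n) * c ^ Suc n * exp (\<theta> * x) / x)"
    using assms by (subst ennreal_mult'[symmetric]) auto
  ultimately show ?thesis by simp
qed

lemma ker_pow_finite: "ker_pow n x < \<infinity>"
  using ker_pow_le[of x n] ker_pow_halfline[of x n]
  by (cases "x > 0") (auto simp: not_less intro: le_less_trans)

lemma prim_finite: "prim n x < \<infinity>"
  using prim_le[of n x] by (auto intro: le_less_trans)

lemma continuous_ker: "continuous_on {0<..} ker"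
  using continuous_on_ennreal[OF cont] by (rule continuous_on_eq) (simp add: ker_def)

lemma continuous_ker_pow: "continuous_on {0<..} (ker_pow n)"
proof (induction n)
  case 0
  show ?case
    using continuous_ker by (simp add: ker_pow_def)
next
  case (Suc n)
  have ker: "ker = ker_pow 0" by (simp add: ker_pow_def)
  have "continuous_on {0<..} (conv (ker_pow n) ker)"
  proof (rule continuous_conv[where \<theta> = \<theta>])
    show "ker x < \<infinity>" for x
      using ker_pow_finite[of 0] by (simp add: ker)
  qed (use Suc \<theta>_pos continuous_ker in \<open>auto simp: ker_pow_halfline ker_halfline ker_pow_finite[simplified] laplace_ker_pow laplace_ker\<close>)
  then show ?case by (simp add: ker_pow_Suc)
qed

lemma continuous_enn2real_ker_pow: "continuous_on {0<..} (\<lambda>x. enn2real (ker_pow n x))"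
  unfolding continuous_on_def
proof (intro ballI tendsto_enn2real)
  fix x :: real assume "x \<in> {0<..}"
  then show "(ker_pow n \<longlongrightarrow> ennreal (enn2real (ker_pow n x))) (at x within {0<..})"
    using continuous_ker_pow[of n] ker_pow_finite[of n x] by (simp add: continuous_on_def)
qed simp

text \<open>The primitive starts at \<open>0\<close>, where the integrand may be singular. Starting at \<open>b > 0\<close>
  instead changes it by a constant and makes the fundamental theorem of calculus applicable.\<close>

lemma prim_Suc_eq_integral:
  assumes "0 < b" "b \<le> y"
  shows "enn2real (prim (Suc n) y) = enn2real (prim (Suc n) b) + integral {b..y} (\<lambda>z. enn2real (ker_pow n z))"
proof -
  let ?p = "\<lambda>z. enn2real (ker_pow n z)"
  have ker_pow_eq: "ker_pow n z = ennreal (?p z)" for z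
    using ker_pow_finite[of n z] by simp
  have "continuous_on {b..y} (\<lambda>z. enn2real (ker_pow n z))"
    using assms by (intro continuous_on_subset[OF continuous_enn2real_ker_pow]) auto
  then have int: "set_integrable lborel {b..y} ?p"
    by (rule borel_integrable_atLeastAtMost')
  have prim_eq: "prim (Suc n) y = (\<integral>\<^sup>+z. ker_pow n z * indicator {0<..<y} z \<partial>lborel)" for y
    unfolding prim_Suc by (rule conv_indicator_halfline) (auto simp: ker_pow_halfline)
  have "prim (Suc n) y = (\<integral>\<^sup>+z. ker_pow n z * indicator {0<..<b} z
      + ennreal (indicator {b..y} z *\<^sub>R ?p z) \<partial>lborel)"
    unfolding prim_eq using AE_lborel_singleton[of b] AE_lborel_singleton[of y]
    by (intro nn_integral_cong_AE, eventually_elim)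
      (use assms in \<open>auto simp: indicator_def ker_pow_eq[symmetric]\<close>)
  also have "\<dots> = prim (Suc n) b + (\<integral>\<^sup>+z. ennreal (indicator {b..y} z *\<^sub>R ?p z) \<partial>lborel)"
    unfolding prim_eq by (rule nn_integral_add) measurable
  also have "(\<integral>\<^sup>+z. ennreal (indicator {b..y} z *\<^sub>R ?p z) \<partial>lborel)
      = ennreal (LINT z|lborel. indicator {b..y} z *\<^sub>R ?p z)"
    using int by (intro nn_integral_eq_integral) (auto simp: set_integrable_def)
  also have "(LINT z|lborel. indicator {b..y} z *\<^sub>R ?p z) = integral {b..y} ?p"
    using set_borel_integral_eq_integral(2)[OF int] by (simp add: set_lebesgue_integral_def)
  finally show ?thesis
    using prim_finite[of "Suc n" b] set_borel_integral_eq_integral(1)[OF int]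
    by (simp add: enn2real_plus integral_nonneg)
qed

lemma prim_has_derivative:
  assumes "x > 0"
  shows "((\<lambda>x. enn2real (prim (Suc n) x)) has_real_derivative enn2real (ker_pow n x)) (at x)"
proof -
  let ?p = "\<lambda>z. enn2real (ker_pow n z)"
  have "continuous_on {x/2..2*x} ?p"
    using assms by (intro continuous_on_subset[OF continuous_enn2real_ker_pow]) auto
  then have "((\<lambda>y. integral {x/2..y} ?p) has_real_derivative ?p x) (at x within {x/2..2*x})"
    using assms by (intro integral_has_real_derivative) auto
  then have "((\<lambda>y. integral {x/2..y} ?p) has_real_derivative ?p x) (at x)"
    using assms at_within_Icc_at[of "x/2" x "2*x"] by simp
  then have "((\<lambda>y. enn2real (prim (Suc n) (x/2)) + integral {x/2..y} ?p) has_real_derivative ?p x) (at x)"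
    by (auto intro!: derivative_eq_intros)
  then show ?thesis
  proof (rule has_field_derivative_transform_within_open)
    show "open {x/2<..<2*x}" "x \<in> {x/2<..<2*x}"
      using assms by auto
    show "enn2real (prim (Suc n) (x/2)) + integral {x/2..y} ?p = enn2real (prim (Suc n) y)"
      if "y \<in> {x/2<..<2*x}" for y
      using prim_Suc_eq_integral[of "x/2" y n] assms that by simp
  qed
qed

text \<open>The derivative of \<open>prim n\<close> on \<open>(0, \<infinity>)\<close>.\<close>

definition prim' :: "nat \<Rightarrow> real \<Rightarrow> real" where
  "prim' n x = (case n of 0 \<Rightarrow> 0 | Suc m \<Rightarrow> enn2real (ker_pow m x))"

lemma prim_has_derivative_prim':
  assumes "x > 0"
  shows "((\<lambda>x. enn2real (prim n x)) has_real_derivative prim' n x) (at x)"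
proof (cases n)
  case 0
  have "((\<lambda>x. 1) has_real_derivative 0) (at x)" by simp
  then have "((\<lambda>x. enn2real (prim 0 x)) has_real_derivative 0) (at x)"
    by (rule has_field_derivative_transform_within_open[where S = "{0<..}"])
      (use assms in \<open>auto simp: prim_def\<close>)
  then show ?thesis by (simp add: 0 prim'_def)
qed (use prim_has_derivative[OF assms] in \<open>simp add: prim'_def\<close>)

lemma continuous_prim': "continuous_on {0<..} (prim' n)"
  by (cases n) (auto simp: prim'_def[abs_def] continuous_enn2real_ker_pow)

lemma prim'_nonneg: "0 \<le> prim' n x"
  by (cases n) (auto simp: prim'_def)

lemma prim'_le:
  assumes "x > 0"
  shows "prim' n x \<le> real n * c ^ n * exp (\<theta> * x) / x"
proof (cases n)
  case (Suc m)
  have "0 \<le> real (Suc m) * c ^ Suc m * exp (\<theta> * x) / x"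
    using assms c_nonneg by simp
  then show ?thesis
    using ker_pow_le[OF assms, of m] Suc by (simp add: prim'_def enn2real_leI del: of_nat_Suc power_Suc)
qed (simp add: prim'_def)

text \<open>The recursion of the convolution powers of \<open>\<eta>\<close>, up to the sign.\<close>

lemma prim_Suc_eq_set_integral:
  assumes "0 < x"
  shows "enn2real (prim (Suc n) x) = (LINT y:{0..x}|lborel. enn2real (prim n (x - y)) * a y)"
proof -
  let ?g = "\<lambda>y. indicator {0..x} y *\<^sub>R (enn2real (prim n (x - y)) * a y)"
  have "prim (Suc n) x = (\<integral>\<^sup>+y. prim n (x - y) * ker y * indicator {0<..<x} y \<partial>lborel)"
    unfolding prim_def conv_pow.simps
    by (rule conv_halfline) (auto simp: ker_halfline prim_halfline[unfolded prim_def])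
  also have "\<dots> = (\<integral>\<^sup>+y. ennreal (?g y) \<partial>lborel)"
    using AE_lborel_singleton[of 0] AE_lborel_singleton[of x]
  proof (intro nn_integral_cong_AE, eventually_elim)
    fix y assume "y \<noteq> 0" "y \<noteq> x"
    show "prim n (x - y) * ker y * indicator {0<..<x} y = ennreal (?g y)"
    proof (cases "y \<in> {0<..<x}")
      case True
      then show ?thesis
        using prim_finite[of n "x - y"] nonneg[of y] by (simp add: ker_def ennreal_mult)
    qed (use \<open>y \<noteq> 0\<close> \<open>y \<noteq> x\<close> in \<open>auto simp: indicator_def\<close>)
  qed
  finally show ?thesis
    unfolding set_lebesgue_integral_def using nonneg
    by (subst integral_eq_nn_integral) auto
qed

end

section \<open>The renewal series\<close>

locale renewal_series = decreasing_kernel +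
  fixes \<delta> :: real
  assumes c_less: "c < \<delta>"
begin

definition renewal_term :: "nat \<Rightarrow> real \<Rightarrow> real" where
  "renewal_term n x = (-1) ^ n * enn2real (prim n x) / \<delta> ^ (n + 1)"

definition renewal_term' :: "nat \<Rightarrow> real \<Rightarrow> real" where
  "renewal_term' n x = (-1) ^ n * prim' n x / \<delta> ^ (n + 1)"

definition renewal_sum :: "real \<Rightarrow> real" where
  "renewal_sum x = (\<Sum>n. renewal_term n x)"

definition renewal_sum' :: "real \<Rightarrow> real" where
  "renewal_sum' x = (\<Sum>n. renewal_term' n x)"

lemma \<delta>_pos: "0 < \<delta>"
  using c_less c_nonneg by simp

lemma abs_renewal_term_le: "\<bar>renewal_term n x\<bar> \<le> exp (\<theta> * x) / \<delta> * (c / \<delta>) ^ n"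
proof -
  have "enn2real (prim n x) \<le> exp (\<theta> * x) * c ^ n"
    using prim_le[of n x] c_nonneg by (intro enn2real_leI) auto
  then show ?thesis
    using \<delta>_pos by (simp add: renewal_term_def abs_mult power_divide field_simps)
qed

lemma summable_renewal_term: "summable (\<lambda>n. renewal_term n x)"
proof (rule summable_comparison_test'[where N = 0])
  show "summable (\<lambda>n. exp (\<theta> * x) / \<delta> * (c / \<delta>) ^ n)"
    using c_less c_nonneg by (intro summable_mult summable_geometric) simp
  show "norm (renewal_term n x) \<le> exp (\<theta> * x) / \<delta> * (c / \<delta>) ^ n" for n
    using abs_renewal_term_le by simp
qed

lemma renewal_term_has_derivative:
  "x > 0 \<Longrightarrow> (renewal_term n has_real_derivative renewal_term' n x) (at x)"
  unfolding renewal_term_def renewal_term'_def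
  by (intro DERIV_cdivide DERIV_cmult prim_has_derivative_prim')

text \<open>The pointwise bounds on the convolution powers are uniform on compact subsets of \<open>(0, \<infinity>)\<close>,
  and they are summable because \<open>\<Sum>n. n * (c / \<delta>) ^ n\<close> converges.\<close>

lemma uniform_limit_renewal_sum':
  assumes "0 < b"
  shows "uniform_limit {b..d} (\<lambda>n x. \<Sum>i<n. renewal_term' i x) renewal_sum' sequentially"
  unfolding renewal_sum'_def
proof (rule Weierstrass_m_test)
  fix n x assume x: "x \<in> {b..d}"
  have "prim' n x \<le> real n * c ^ n * exp (\<theta> * x) / x"
    using x assms by (intro prim'_le) auto
  also have "\<dots> \<le> real n * c ^ n * exp (\<theta> * d) / b"
    using x assms c_nonneg \<theta>_pos by (intro frac_le mult_left_mono) auto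
  finally have "prim' n x / \<delta> ^ (n + 1) \<le> real n * c ^ n * exp (\<theta> * d) / b / \<delta> ^ (n + 1)"
    using \<delta>_pos by (intro divide_right_mono) auto
  then show "norm (renewal_term' n x) \<le> exp (\<theta> * d) / (b * \<delta>) * (real n * (c / \<delta>) ^ n)"
    using \<delta>_pos prim'_nonneg[of n x] by (simp add: renewal_term'_def abs_mult power_divide mult_ac)
next
  have "norm (c / \<delta>) < 1"
    using c_less c_nonneg by simp
  then have "summable (\<lambda>n. c / \<delta> * (real (Suc n) * (c / \<delta>) ^ n))"
    using geometric_deriv_sums[of "c / \<delta>"] by (intro summable_mult) (auto simp: sums_iff)
  then have "summable (\<lambda>n. real (Suc n) * (c / \<delta>) ^ Suc n)"
    by (simp add: mult_ac)
  then have "summable (\<lambda>n. real n * (c / \<delta>) ^ n)"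
    by (subst (asm) summable_Suc_iff)
  then show "summable (\<lambda>n. exp (\<theta> * d) / (b * \<delta>) * (real n * (c / \<delta>) ^ n))"
    by (rule summable_mult)
qed

lemma continuous_renewal_sum': "continuous_on {0<..} renewal_sum'"
proof -
  have "isCont renewal_sum' x" if "x > 0" for x
  proof -
    have "continuous_on {x/2..2*x} renewal_sum'"
    proof (rule uniform_limit_theorem[OF _ uniform_limit_renewal_sum'])
      show "\<forall>\<^sub>F n in sequentially. continuous_on {x/2..2*x} (\<lambda>x. \<Sum>i<n. renewal_term' i x)"
        unfolding renewal_term'_def using that \<delta>_pos
        by (intro always_eventually allI continuous_intros continuous_on_subset[OF continuous_prim']) auto
    qed (use that in auto)
    then show ?thesis
      using that by (intro continuous_on_interior) auto
  qed
  then show ?thesis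
    by (auto intro: continuous_at_imp_continuous_on)
qed

lemma renewal_sum'_sums:
  assumes "x > 0"
  shows "(\<lambda>n. renewal_term' n x) sums renewal_sum' x"
  using tendsto_uniform_limitI[OF uniform_limit_renewal_sum'[of x x], of x] assms
  by (simp add: sums_def)

lemma renewal_sum_has_derivative:
  assumes "x > 0"
  shows "(renewal_sum has_real_derivative renewal_sum' x) (at x)"
proof -
  have "((\<lambda>x. \<Sum>n. renewal_term n x) has_field_derivative (\<Sum>n. renewal_term' n x)) (at x)"
  proof (rule has_field_derivative_series'(2))
    show "convex {x/2..2*x}" "x \<in> interior {x/2..2*x}" "x \<in> {x/2..2*x}"
      using assms by auto
    show "(renewal_term n has_real_derivative renewal_term' n y) (at y within {x/2..2*x})"
      if "y \<in> {x/2..2*x}" for n y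
      by (rule has_field_derivative_at_within, rule renewal_term_has_derivative)
        (use that assms in auto)
    show "uniformly_convergent_on {x/2..2*x} (\<lambda>n x. \<Sum>i<n. renewal_term' i x)"
      using uniform_limit_renewal_sum'[of "x/2" "2*x"] assms
      unfolding uniformly_convergent_on_def by auto
    show "summable (\<lambda>n. renewal_term n x)"
      by (rule summable_renewal_term)
  qed
  then show ?thesis
    unfolding renewal_sum_def[abs_def] renewal_sum'_def .
qed

lemma laplace_ker_mono:
  assumes "\<theta> \<le> s"
  shows "laplace s ker \<le> ennreal c"
  unfolding laplace_ker[symmetric] laplace_def
proof (rule nn_integral_mono)
  fix x
  show "ennreal (exp (- s * x)) * ker x \<le> ennreal (exp (- \<theta> * x)) * ker x"
    using assms by (cases "x > 0") (auto simp: ker_halfline intro!: mult_right_mono ennreal_leI)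
qed

text \<open>Term by term the transform is the geometric series
  \<open>\<Sum>n. (- cs) ^ n / (s * \<delta> ^ (n + 1)) = 1 / (s * (\<delta> + cs))\<close>.\<close>

lemma laplace_renewal_sum:
  assumes "\<theta> \<le> s" and cs: "laplace s ker = ennreal cs" "0 \<le> cs"
  shows "integrable lborel (\<lambda>x. indicator {0<..} x * (exp (- s * x) * renewal_sum x))" (is ?int)
    and "(LINT x|lborel. indicator {0<..} x * (exp (- s * x) * renewal_sum x)) = 1 / (s * (\<delta> + cs))" (is ?eq)
proof -
  have s: "0 < s" using assms \<theta>_pos by simp
  have "cs \<le> c"
    using laplace_ker_mono[OF assms(1)] cs c_nonneg by simp
  then have r: "cs / \<delta> < 1" "0 \<le> cs / \<delta>"
    using c_less \<delta>_pos cs by auto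
  then have r_norm: "norm (cs / \<delta>) < 1"
    by (simp only: real_norm_def abs_of_nonneg)
  define G where "G n x = indicator {0<..} x * (exp (- s * x) * renewal_term n x)" for n x
  define H where "H n x = exp (- s * x) * enn2real (prim n x)" for n x
  have H: "integrable lborel (H n)" "(LINT x|lborel. H n x) = 1 / s * cs ^ n" for n
  proof -
    have [measurable]: "H n \<in> borel_measurable borel"
      unfolding H_def by measurable
    have "(\<integral>\<^sup>+x. ennreal (H n x) \<partial>lborel) = laplace s (prim n)"
      unfolding laplace_def H_def
      by (rule nn_integral_cong) (use prim_finite in \<open>simp add: ennreal_mult'\<close>)
    also have "\<dots> = ennreal (1 / s * cs ^ n)"
      using s cs
      by (simp add: laplace_prim ennreal_power ennreal_mult'[symmetric] del: divide_const_simps)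
    finally have *: "(\<integral>\<^sup>+x. ennreal (H n x) \<partial>lborel) = ennreal (1 / s * cs ^ n)" .
    have "AE x in lborel. 0 \<le> H n x"
      by (simp add: H_def)
    then show "integrable lborel (H n)" "(LINT x|lborel. H n x) = 1 / s * cs ^ n"
      using nn_integral_eq_integrable[of "H n" lborel "1 / s * cs ^ n"] s cs *
      by simp_all
  qed
  have G_H: "G n x = (-1) ^ n / \<delta> ^ (n + 1) * H n x" for n x
    by (cases "x > 0") (auto simp: G_def H_def renewal_term_def prim_halfline)
  have norm_G: "norm (G n x) = 1 / \<delta> ^ (n + 1) * H n x" for n x
    using \<delta>_pos by (simp add: G_H abs_mult H_def)
  have G_int: "integrable lborel (G n)" for n
    unfolding G_H[abs_def] using H by simp
  have G_val: "(LINT x|lborel. G n x) = 1 / (s * \<delta>) * (- (cs / \<delta>)) ^ n" for n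
    unfolding G_H using H by (simp add: power_divide power_minus[of "cs / \<delta>"])
  have "(LINT x|lborel. norm (G n x)) = 1 / (s * \<delta>) * (cs / \<delta>) ^ n" for n
    unfolding norm_G using H by (simp add: power_divide)
  then have sum_norm: "summable (\<lambda>n. LINT x|lborel. norm (G n x))"
    using r_norm by (simp only: summable_mult summable_geometric)
  have AE_sum: "AE x in lborel. summable (\<lambda>n. norm (G n x))"
  proof (rule AE_I2, rule summable_comparison_test'[where N = 0])
    fix x n
    show "summable (\<lambda>n. exp (- s * x) * (exp (\<theta> * x) / \<delta> * (c / \<delta>) ^ n))"
      using c_less c_nonneg by (intro summable_mult summable_geometric) simp
    show "norm (norm (G n x)) \<le> exp (- s * x) * (exp (\<theta> * x) / \<delta> * (c / \<delta>) ^ n)"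
    proof -
      let ?B = "exp (\<theta> * x) / \<delta> * (c / \<delta>) ^ n"
      have "exp (- s * x) * \<bar>renewal_term n x\<bar> \<le> exp (- s * x) * ?B"
        by (intro mult_left_mono abs_renewal_term_le) simp
      moreover have "0 \<le> exp (- s * x) * ?B"
        using \<delta>_pos c_nonneg by simp
      moreover have "norm (norm (G n x)) = (if 0 < x then exp (- s * x) * \<bar>renewal_term n x\<bar> else 0)"
        by (simp add: G_def abs_mult)
      ultimately show ?thesis
        by (simp only: simp_thms split: if_split)
    qed
  qed
  have sum_eq: "(\<Sum>n. G n x) = indicator {0<..} x * (exp (- s * x) * renewal_sum x)" for x
    unfolding G_def renewal_sum_def using summable_renewal_term[of x]
    by (simp add: suminf_mult summable_mult)
  show ?int
    using integrable_suminf[OF G_int AE_sum sum_norm] by (simp add: sum_eq)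
  have "(\<lambda>n. 1 / (s * \<delta>) * (- (cs / \<delta>)) ^ n) sums (1 / (s * \<delta>) * (1 / (1 - - (cs / \<delta>))))"
    using r_norm by (intro sums_mult geometric_sums) (simp only: norm_minus_cancel)
  moreover have "(\<lambda>n. 1 / (s * \<delta>) * (- (cs / \<delta>)) ^ n) sums
      (LINT x|lborel. indicator {0<..} x * (exp (- s * x) * renewal_sum x))"
    using sums_integral[OF G_int AE_sum sum_norm] by (simp add: sum_eq G_val)
  ultimately have "(LINT x|lborel. indicator {0<..} x * (exp (- s * x) * renewal_sum x))
      = 1 / (s * \<delta>) * (1 / (1 - - (cs / \<delta>)))"
    by (metis sums_unique2)
  also have "\<dots> = 1 / (s * (\<delta> + cs))"
    using \<delta>_pos s cs by (simp add: field_simps)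
  finally show ?eq .
qed

end

section \<open>The tail of the L\'evy measure\<close>

text \<open>The jump part of the Laplace exponent of the subordinator.\<close>

definition levy_exponent :: "real measure \<Rightarrow> real \<Rightarrow> real" where
  "levy_exponent \<mu> s = (LINT x|\<mu>. 1 - exp (- s * x))"

context
  fixes \<mu> :: "real measure"
  assumes levy: "subordinator_levy_measure \<mu>"
begin

lemma sets_levy [measurable_cong]: "sets \<mu> = sets borel"
  using levy by (simp add: subordinator_levy_measure_def)

lemma space_levy: "space \<mu> = UNIV"
  using sets_eq_imp_space_eq[OF sets_levy] by simp

lemma AE_levy_pos: "AE x in \<mu>. 0 < x"
proof -
  have "{..0} \<in> null_sets \<mu>"
    using levy by (auto simp: subordinator_levy_measure_def null_sets_def)
  then show ?thesis
    by (rule AE_I') auto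
qed

lemma integrable_min_one: "integrable \<mu> (\<lambda>x. min 1 x)"
proof (rule integrableI_nonneg)
  show "AE x in \<mu>. 0 \<le> min 1 x"
    using AE_levy_pos by eventually_elim auto
  show "(\<integral>\<^sup>+x. ennreal (min 1 x) \<partial>\<mu>) < \<infinity>"
    using levy by (simp add: subordinator_levy_measure_def)
qed (auto simp: measurable_cong_sets[OF sets_levy refl])

text \<open>Markov's inequality for \<open>min 1 x\<close>.\<close>

lemma emeasure_levy_Ici_finite:
  assumes "0 < e"
  shows "emeasure \<mu> {e..} < \<infinity>"
proof -
  have "ennreal (min 1 e) * emeasure \<mu> {e..} = (\<integral>\<^sup>+x. ennreal (min 1 e) * indicator {e..} x \<partial>\<mu>)"
    by (simp add: nn_integral_cmult_indicator sets_levy)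
  also have "\<dots> \<le> (\<integral>\<^sup>+x. ennreal (min 1 x) \<partial>\<mu>)"
    by (rule nn_integral_mono) (auto simp: indicator_def intro!: ennreal_leI)
  also have "\<dots> < \<infinity>"
    using levy by (simp add: subordinator_levy_measure_def)
  finally show ?thesis
    using assms by (auto simp: ennreal_mult_less_top)
qed

lemma emeasure_levy_Ioi_finite:
  assumes "0 < e"
  shows "emeasure \<mu> {e<..} < \<infinity>"
proof -
  have "emeasure \<mu> {e<..} \<le> emeasure \<mu> {e..}"
    by (intro emeasure_mono) (auto simp: sets_levy)
  then show ?thesis
    using emeasure_levy_Ici_finite[OF assms] by simp
qed

text \<open>\<open>\<mu>\<close> may have infinite mass near \<open>0\<close>, but Fubini applies since the mass of each \<open>[1/n, \<infinity>)\<close> is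
  finite.\<close>

lemma sigma_finite_levy: "sigma_finite_measure \<mu>"
proof
  let ?A = "insert {..0} (range (\<lambda>n. {1 / real (Suc n)..}))"
  have "\<exists>n. 1 / real (Suc n) \<le> x" if "0 < x" for x :: real
    using nat_approx_posE[OF that] by (metis less_imp_le)
  then have "\<Union> ?A = space \<mu>"
    by (force simp: space_levy not_le)
  moreover have "\<forall>a\<in>?A. emeasure \<mu> a \<noteq> \<infinity>"
    using levy emeasure_levy_Ici_finite
    by (auto simp: subordinator_levy_measure_def less_top[symmetric])
  moreover have "?A \<subseteq> sets \<mu>"
    by (auto simp: sets_levy)
  ultimately show "\<exists>A. countable A \<and> A \<subseteq> sets \<mu> \<and> \<Union> A = space \<mu> \<and> (\<forall>a\<in>A. emeasure \<mu> a \<noteq> \<infinity>)"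
    by (intro exI[of _ ?A]) auto
qed

lemma levy_tail_measurable: "levy_tail q \<mu> \<in> borel_measurable borel"
proof -
  interpret sigma_finite_measure \<mu> by (rule sigma_finite_levy)
  have [measurable]: "(\<lambda>(x, y). indicator {x<..} y :: ennreal) \<in> borel_measurable (borel \<Otimes>\<^sub>M \<mu>)"
    unfolding indicator_def greaterThan_iff by measurable
  have "(\<lambda>x. \<integral>\<^sup>+y. indicator {x<..} y \<partial>\<mu>) \<in> borel_measurable borel"
    by measurable
  then have [measurable]: "(\<lambda>x. emeasure \<mu> {x<..}) \<in> borel_measurable borel"
    by (simp add: sets_levy)
  show ?thesis
    unfolding levy_tail_def[abs_def] Sigma_Algebra.measure_def by measurable
qed

lemma levy_tail_antimono:
  assumes "0 < x" "x \<le> y"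
  shows "levy_tail q \<mu> y \<le> levy_tail q \<mu> x"
proof -
  have "measure \<mu> {y<..} \<le> measure \<mu> {x<..}"
    using assms emeasure_levy_Ioi_finite[OF assms(1)]
    by (intro measure_mono_fmeasurable) (auto simp: sets_levy fmeasurable_def)
  then show ?thesis by (simp add: levy_tail_def)
qed

lemma levy_tail_nonneg: "0 \<le> q \<Longrightarrow> 0 \<le> levy_tail q \<mu> x"
  by (simp add: levy_tail_def)

text \<open>Between nearby arguments the tail changes by the mass of a small interval, which tends to the
  mass of a point; this is where the absence of atoms enters.\<close>

lemma continuous_levy_tail:
  assumes atomless: "\<forall>x>0. emeasure \<mu> {x} = 0"
  shows "continuous_on {0<..} (levy_tail q \<mu>)"
proof -
  have "(\<lambda>n. measure \<mu> {X n<..}) \<longlonglongrightarrow> measure \<mu> {x<..}"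
    if x: "0 < x" and X: "X \<longlonglongrightarrow> x" for X x
  proof -
    have "eventually (\<lambda>n. X n > x/2) sequentially"
      using X x by (intro order_tendstoD(1)[OF X]) auto
    then obtain N where N: "\<And>n. n \<ge> N \<Longrightarrow> X n > x/2"
      by (auto simp: eventually_sequentially)
    have XN: "(\<lambda>n. X (n + N)) \<longlonglongrightarrow> x"
      using X by (rule LIMSEQ_ignore_initial_segment)
    have int: "integrable \<mu> (indicator {y<..} :: real \<Rightarrow> real)" if "0 < y" for y
      using emeasure_levy_Ioi_finite[OF that] by (simp add: integrable_indicator_iff sets_levy space_levy)
    have meas: "(\<integral>z. indicator {y<..} z \<partial>\<mu>) = measure \<mu> {y<..}" for y
      by (simp add: space_levy)
    have "{x} \<in> null_sets \<mu>"
      using atomless x by (auto simp: null_sets_def sets_levy)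
    then have AE_ne: "AE z in \<mu>. z \<noteq> x"
      by (rule AE_I') auto
    have "(\<lambda>n. \<integral>z. indicator {X (n + N)<..} z \<partial>\<mu>) \<longlonglongrightarrow> (\<integral>z. (indicator {x<..} z :: real) \<partial>\<mu>)"
    proof (rule integral_dominated_convergence[where w = "indicator {x/2<..}"])
      show "integrable \<mu> (indicator {x/2<..} :: real \<Rightarrow> real)"
        using int x by simp
      show "AE z in \<mu>. norm (indicator {X (n + N)<..} z :: real) \<le> indicator {x/2<..} z" for n
        using N[of "n + N"] by (intro AE_I2) (auto simp: indicator_def)
      show "AE z in \<mu>. (\<lambda>n. indicator {X (n + N)<..} z) \<longlonglongrightarrow> (indicator {x<..} z :: real)"
        using AE_ne
      proof eventually_elim
        fix z assume "z \<noteq> x"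
        then consider "z < x" | "x < z" by linarith
        then have "eventually (\<lambda>n. indicator {X (n + N)<..} z = (indicator {x<..} z :: real)) sequentially"
        proof cases
          case 1
          have "eventually (\<lambda>n. z < X (n + N)) sequentially"
            using 1 by (rule order_tendstoD(1)[OF XN])
          then show ?thesis
            by eventually_elim (use 1 in auto)
        next
          case 2
          have "eventually (\<lambda>n. X (n + N) < z) sequentially"
            using 2 by (rule order_tendstoD(2)[OF XN])
          then show ?thesis
            by eventually_elim (use 2 in auto)
        qed
        then show "(\<lambda>n. indicator {X (n + N)<..} z) \<longlonglongrightarrow> (indicator {x<..} z :: real)"
          by (rule tendsto_eventually)
      qed
    qed (auto simp: sets_levy)
    then have "(\<lambda>n. measure \<mu> {X (n + N)<..}) \<longlonglongrightarrow> measure \<mu> {x<..}"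
      unfolding meas .
    then show ?thesis
      by (rule LIMSEQ_offset)
  qed
  then have "isCont (\<lambda>x. measure \<mu> {x<..}) x" if "0 < x" for x
    using that by (auto simp: continuous_at_sequentially o_def)
  then have "continuous_on {0<..} (\<lambda>x. measure \<mu> {x<..})"
    by (auto intro: continuous_at_imp_continuous_on)
  then show ?thesis
    unfolding levy_tail_def[abs_def] by (intro continuous_intros)
qed

lemma integrable_levy_exponent:
  assumes "0 \<le> s"
  shows "integrable \<mu> (\<lambda>x. 1 - exp (- s * x))"
proof (rule Bochner_Integration.integrable_bound)
  show "integrable \<mu> (\<lambda>x. (1 + s) * min 1 x)"
    by (intro integrable_mult_right integrable_min_one)
  show "AE x in \<mu>. norm (1 - exp (- s * x)) \<le> norm ((1 + s) * min 1 x)"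
    using AE_levy_pos
  proof eventually_elim
    fix x :: real assume x: "0 < x"
    have "1 - exp (- s * x) \<le> s * x"
      using exp_ge_add_one_self[of "- s * x"] by simp
    moreover have "0 \<le> 1 - exp (- s * x)" "1 - exp (- s * x) \<le> 1"
      using x assms by auto
    moreover have "(1 + s) * min 1 x \<ge> min (s * x) 1" "0 \<le> (1 + s) * min 1 x"
      using x assms by (auto simp: min_def algebra_simps)
    ultimately have "1 - exp (- s * x) \<le> (1 + s) * min 1 x"
      by linarith
    then show "norm (1 - exp (- s * x)) \<le> norm ((1 + s) * min 1 x)"
      using \<open>0 \<le> 1 - exp (- s * x)\<close> \<open>0 \<le> (1 + s) * min 1 x\<close>
      by (simp only: real_norm_def abs_of_nonneg)
  qed
qed (auto simp: measurable_cong_sets[OF sets_levy refl])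

lemma levy_exponent_nonneg:
  assumes "0 \<le> s"
  shows "0 \<le> levy_exponent \<mu> s"
  unfolding levy_exponent_def using AE_levy_pos
  by (intro integral_nonneg_AE, eventually_elim) (use assms in auto)

text \<open>Integration by parts, in the form of Fubini applied to
  \<open>1 - exp (- s * y) = s * (\<integral> exp (- s * x))\<close> over \<open>(0, y)\<close>.\<close>

lemma laplace_levy_tail:
  assumes "0 < s" "0 \<le> q"
  shows "laplace s (\<lambda>x. indicator {0<..} x * ennreal (levy_tail q \<mu> x)) = ennreal ((q + levy_exponent \<mu> s) / s)"
proof -
  interpret sigma_finite_measure \<mu> by (rule sigma_finite_levy)
  interpret pair_sigma_finite lborel \<mu> ..
  have [measurable]: "(\<lambda>(x, y). indicator {x<..} y :: ennreal) \<in> borel_measurable (lborel \<Otimes>\<^sub>M \<mu>)"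
    unfolding indicator_def greaterThan_iff by measurable
  have tail: "indicator {0<..} x * ennreal (levy_tail q \<mu> x)
      = indicator {0<..} x * ennreal q + indicator {0<..} x * (\<integral>\<^sup>+y. indicator {x<..} y \<partial>\<mu>)" for x
  proof (cases "0 < x")
    case True
    then have "emeasure \<mu> {x<..} = ennreal (measure \<mu> {x<..})"
      using emeasure_levy_Ioi_finite[OF True] by (simp add: emeasure_eq_ennreal_measure less_top)
    then show ?thesis
      using assms by (simp add: levy_tail_def ennreal_plus sets_levy distrib_left)
  qed simp
  have "laplace s (\<lambda>x. indicator {0<..} x * ennreal (levy_tail q \<mu> x))
      = (\<integral>\<^sup>+x. ennreal (exp (- s * x)) * indicator {0<..} x * ennreal q
        + (\<integral>\<^sup>+y. ennreal (exp (- s * x)) * indicator {0<..} x * indicator {x<..} y \<partial>\<mu>) \<partial>lborel)"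
    unfolding laplace_def tail
    by (rule nn_integral_cong) (simp add: distrib_left mult.assoc nn_integral_cmult sets_levy)
  also have "\<dots> = laplace s (indicator {0<..}) * ennreal q
      + (\<integral>\<^sup>+x. (\<integral>\<^sup>+y. ennreal (exp (- s * x)) * indicator {0<..} x * indicator {x<..} y \<partial>\<mu>) \<partial>lborel)"
    unfolding laplace_def by (subst nn_integral_add, measurable) (simp add: nn_integral_multc)
  also have "(\<integral>\<^sup>+x. (\<integral>\<^sup>+y. ennreal (exp (- s * x)) * indicator {0<..} x * indicator {x<..} y \<partial>\<mu>) \<partial>lborel)
      = (\<integral>\<^sup>+y. (\<integral>\<^sup>+x. ennreal (exp (- s * x)) * indicator {0<..} x * indicator {x<..} y \<partial>lborel) \<partial>\<mu>)"
    by (rule Fubini'[symmetric]) measurable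
  also have "\<dots> = (\<integral>\<^sup>+y. ennreal ((1 - exp (- s * y)) / s) \<partial>\<mu>)"
    using AE_levy_pos
  proof (intro nn_integral_cong_AE, eventually_elim)
    fix y :: real assume "0 < y"
    have "(\<integral>\<^sup>+x. ennreal (exp (- s * x)) * indicator {0<..} x * indicator {x<..} y \<partial>lborel)
        = (\<integral>\<^sup>+x. ennreal (exp (- s * x)) * indicator {0<..<y} x \<partial>lborel)"
      by (rule nn_integral_cong) (auto simp: indicator_def)
    then show "(\<integral>\<^sup>+x. ennreal (exp (- s * x)) * indicator {0<..} x * indicator {x<..} y \<partial>lborel)
        = ennreal ((1 - exp (- s * y)) / s)"
      using nn_integral_exp_Ioo[OF assms(1) \<open>0 < y\<close>] by simp
  qed
  also have "\<dots> = ennreal (LINT y|\<mu>. (1 - exp (- s * y)) / s)"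
  proof (rule nn_integral_eq_integral)
    show "AE y in \<mu>. 0 \<le> (1 - exp (- s * y)) / s"
      using AE_levy_pos by eventually_elim (use assms in auto)
  qed (use integrable_levy_exponent[of s] assms in simp)
  also have "(LINT y|\<mu>. (1 - exp (- s * y)) / s) = levy_exponent \<mu> s / s"
    by (simp add: levy_exponent_def)
  also have "laplace s (indicator {0<..}) * ennreal q + ennreal (levy_exponent \<mu> s / s)
      = ennreal ((q + levy_exponent \<mu> s) / s)"
    using assms levy_exponent_nonneg[of s]
    by (simp add: laplace_indicator_halfline ennreal_mult'[symmetric] ennreal_plus[symmetric]
        add_divide_distrib del: ennreal_plus)
  finally show ?thesis .
qed

text \<open>The Laplace exponent of a driftless subordinator is \<open>o(s)\<close>: \<open>(1 - exp (- s * x)) / s\<close> tends to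
  \<open>0\<close> and is dominated by \<open>min 1 x\<close> for \<open>s \<ge> 1\<close>.\<close>

lemma levy_exponent_sublinear: "(\<lambda>n. levy_exponent \<mu> (real n) / real n) \<longlonglongrightarrow> 0"
proof -
  have "(\<lambda>n. LINT x|\<mu>. (1 - exp (- real n * x)) / real n) \<longlonglongrightarrow> (LINT x|\<mu>. 0)"
  proof (rule integral_dominated_convergence[where w = "\<lambda>x. min 1 x"])
    show "integrable \<mu> (\<lambda>x. min 1 x)"
      by (rule integrable_min_one)
    show "AE x in \<mu>. norm ((1 - exp (- real n * x)) / real n) \<le> min 1 x" for n
      using AE_levy_pos
    proof eventually_elim
      fix x :: real assume x: "0 < x"
      show "norm ((1 - exp (- real n * x)) / real n) \<le> min 1 x"
      proof (cases "n = 0")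
        case False
        then have n: "1 \<le> real n" by simp
        have "1 - exp (- real n * x) \<le> real n * x"
          using exp_ge_add_one_self[of "- real n * x"] by simp
        moreover have "0 \<le> 1 - exp (- real n * x)" "1 - exp (- real n * x) \<le> 1 * real n"
          using x n by (auto intro: order_trans[OF _ n])
        ultimately show ?thesis
          using n by (auto simp: divide_le_eq mult.commute)
      qed (use x in simp)
    qed
    show "AE x in \<mu>. (\<lambda>n. (1 - exp (- real n * x)) / real n) \<longlonglongrightarrow> 0"
      using AE_levy_pos
    proof eventually_elim
      fix x :: real assume "0 < x"
      then show "(\<lambda>n. (1 - exp (- real n * x)) / real n) \<longlonglongrightarrow> 0"
        by real_asymp
    qed
  qed (auto simp: measurable_cong_sets[OF sets_levy refl])
  then show ?thesis
    by (simp add: levy_exponent_def)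
qed

end

section \<open>The renewal measure\<close>

text \<open>The path at time \<open>t\<close> is the limit of its values at the grid points \<open>\<tau> n t > t\<close>, and a
  process sampled along a countable grid is jointly measurable.\<close>

lemma right_continuous_process_jointly_measurable:
  fixes X :: "real \<Rightarrow> 'a \<Rightarrow> real"
  assumes meas: "\<And>t. 0 \<le> t \<Longrightarrow> X t \<in> borel_measurable M"
    and rc: "\<And>t \<omega>. 0 \<le> t \<Longrightarrow> \<omega> \<in> space M \<Longrightarrow> ((\<lambda>s. X s \<omega>) \<longlongrightarrow> X t \<omega>) (at_right t)"
  shows "(\<lambda>p. X (max 0 (snd p)) (fst p)) \<in> borel_measurable (M \<Otimes>\<^sub>M lborel)"
proof -
  have [measurable]: "(snd :: 'a \<times> real \<Rightarrow> real) \<in> borel_measurable (M \<Otimes>\<^sub>M lborel)"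
    using measurable_snd[of M "lborel :: real measure"] by (simp add: measurable_cong_sets[OF refl sets_lborel])
  define \<tau> where "\<tau> n t = (real_of_int \<lfloor>t * real (Suc n)\<rfloor> + 1) / real (Suc n)" for n t
  have \<tau>_gt: "t < \<tau> n t" and \<tau>_le: "\<tau> n t \<le> t + 1 / real (Suc n)" for n t
    unfolding \<tau>_def using floor_correct[of "t * real (Suc n)"]
    by (simp_all add: field_simps del: of_nat_Suc)
  have \<tau>_lim: "filterlim (\<lambda>n. \<tau> n t) (at_right t) sequentially" for t
  proof -
    have "(\<lambda>n. \<tau> n t) \<longlonglongrightarrow> t"
    proof (rule tendsto_sandwich[where f = "\<lambda>_. t" and h = "\<lambda>n. t + 1 / real (Suc n)"])
      show "(\<lambda>n. t + 1 / real (Suc n)) \<longlonglongrightarrow> t"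
        using tendsto_add[OF tendsto_const LIMSEQ_inverse_real_of_nat, of t] by (simp add: inverse_eq_divide)
    qed (use \<tau>_gt \<tau>_le in \<open>auto intro: always_eventually less_imp_le\<close>)
    then show ?thesis
      unfolding filterlim_at using \<tau>_gt by (auto intro!: always_eventually) (metis less_irrefl)
  qed
  show ?thesis
  proof (rule borel_measurable_LIMSEQ_real)
    fix p :: "'a \<times> real" assume "p \<in> space (M \<Otimes>\<^sub>M lborel)"
    then have "fst p \<in> space M" by (auto simp: space_pair_measure)
    then show "(\<lambda>n. X (\<tau> n (max 0 (snd p))) (fst p)) \<longlonglongrightarrow> X (max 0 (snd p)) (fst p)"
      using filterlim_compose[OF rc \<tau>_lim] by simp
  next
    fix n
    define f where "f i p = X (max 0 ((real_of_int i + 1) / real (Suc n))) (fst p)"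
      for i and p :: "'a \<times> real"
    have "(\<lambda>p. f \<lfloor>max 0 (snd p) * real (Suc n)\<rfloor> p) \<in> borel_measurable (M \<Otimes>\<^sub>M lborel)"
    proof (rule measurable_compose_countable)
      show "f i \<in> borel_measurable (M \<Otimes>\<^sub>M lborel)" for i
        unfolding f_def by (rule measurable_compose[OF measurable_fst meas]) simp
    qed measurable
    moreover have "f \<lfloor>max 0 (snd p) * real (Suc n)\<rfloor> p = X (\<tau> n (max 0 (snd p))) (fst p)" for p
    proof -
      have "0 < \<tau> n (max 0 (snd p))"
        using \<tau>_gt[of "max 0 (snd p)" n] by simp
      then show ?thesis
        by (simp add: f_def \<tau>_def max_def del: of_nat_Suc)
    qed
    ultimately show "(\<lambda>p. X (\<tau> n (max 0 (snd p))) (fst p)) \<in> borel_measurable (M \<Otimes>\<^sub>M lborel)"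
      by simp
  qed
qed

text \<open>By independence of the killing time the expectation is a product, with the factors given by the
  exponential law and the L\'evy--Khintchine formula.\<close>

lemma nn_integral_killed_exp:
  assumes sub: "subordinator M H" and char: "has_drift_and_levy_measure M H \<delta> \<mu>"
    and kill: "killing_time M H q \<zeta>" and t: "0 \<le> t" and s: "0 \<le> s"
  shows "(\<integral>\<^sup>+\<omega>. indicator {\<omega>. ereal t < \<zeta> \<omega>} \<omega> * ennreal (exp (- s * H t \<omega>)) \<partial>M)
    = ennreal (exp (- (q + \<delta> * s + levy_exponent \<mu> s) * t))"
proof -
  interpret prob_space M
    using sub by (simp add: subordinator_def)
  have [measurable]: "H t \<in> borel_measurable M"
    using sub t by (simp add: subordinator_def)
  have [measurable]: "\<zeta> \<in> borel_measurable M"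
    using kill by (simp add: killing_time_def)
  define A B where "A \<omega> = (indicator {\<omega>. ereal t < \<zeta> \<omega>} \<omega> :: real)"
    and "B \<omega> = exp (- s * H t \<omega>)" for \<omega>
  have [measurable]: "A \<in> borel_measurable M" "B \<in> borel_measurable M"
    unfolding A_def[abs_def] B_def[abs_def] by measurable
  have EB: "expectation B = exp (- t * (\<delta> * s + levy_exponent \<mu> s))"
    using char t s by (simp add: has_drift_and_levy_measure_def B_def[abs_def] levy_exponent_def)
  \<comment> \<open>A function that is not integrable has integral \<open>0\<close>, but here the integral is the value
    of an exponential function.\<close>
  then have "integrable M B"
    using not_integrable_integral_eq[of M B] by fastforce
  have "integrable M A"
    by (rule integrable_const_bound[where B = 1]) (auto simp: A_def indicator_def)
  have "expectation A = measure M {\<omega> \<in> space M. ereal t < \<zeta> \<omega>}"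
  proof -
    have "expectation A = expectation (indicator {\<omega> \<in> space M. ereal t < \<zeta> \<omega>})"
      by (rule Bochner_Integration.integral_cong) (auto simp: A_def indicator_def)
    then show ?thesis by simp
  qed
  then have EA: "expectation A = exp (- q * t)"
    using kill t by (simp add: killing_time_def)
  let ?VA = "vimage_algebra (space M) \<zeta> borel"
  let ?VB = "vimage_algebra (space M) (\<lambda>\<omega>. \<lambda>t\<in>{0..}. H t \<omega>) (PiM {0..} (\<lambda>_. borel))"
  have [measurable]: "\<zeta> \<in> measurable ?VA borel"
    by (rule measurable_vimage_algebra1) simp
  have A': "A \<in> borel_measurable ?VA"
    unfolding A_def[abs_def] by measurable
  have [measurable]: "(\<lambda>\<omega>. \<lambda>t\<in>{0..}. H t \<omega>) \<in> measurable ?VB (PiM {0..} (\<lambda>_. borel))"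
    by (rule measurable_vimage_algebra1) (auto simp: space_PiM)
  have [measurable]: "(\<lambda>f. f t) \<in> borel_measurable (PiM {0..} (\<lambda>_. borel :: real measure))"
    by (rule measurable_component_singleton) (use t in auto)
  have "(\<lambda>\<omega>. (\<lambda>t\<in>{0..}. H t \<omega>) t) \<in> borel_measurable ?VB"
    by (rule measurable_compose[of "\<lambda>\<omega>. \<lambda>t\<in>{0..}. H t \<omega>"]) measurable
  then have [measurable]: "H t \<in> borel_measurable ?VB"
    using t by simp
  have B': "B \<in> borel_measurable ?VB"
    unfolding B_def[abs_def] by measurable
  have "indep_set (sets ?VA) (sets ?VB)"
    using kill by (simp add: killing_time_def)
  then have "indep_set (sigma_sets (space M) {A -` S \<inter> space M | S. S \<in> sets borel})
      (sigma_sets (space M) {B -` S \<inter> space M | S. S \<in> sets borel})"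
    unfolding indep_set_def
  proof (rule indep_sets_mono_sets)
    have "sigma_sets (space ?VA) {A -` S \<inter> space M | S. S \<in> sets borel} \<subseteq> sets ?VA"
      using measurable_sets[OF A'] by (intro sets.sigma_sets_subset) auto
    moreover have "sigma_sets (space ?VB) {B -` S \<inter> space M | S. S \<in> sets borel} \<subseteq> sets ?VB"
      using measurable_sets[OF B'] by (intro sets.sigma_sets_subset) auto
    ultimately show "(case i of True \<Rightarrow> sigma_sets (space M) {A -` S \<inter> space M | S. S \<in> sets borel}
        | False \<Rightarrow> sigma_sets (space M) {B -` S \<inter> space M | S. S \<in> sets borel})
      \<subseteq> (case i of True \<Rightarrow> sets ?VA | False \<Rightarrow> sets ?VB)" for i
      by (cases i) auto
  qed
  then have indep: "indep_var borel A borel B"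
    by (simp add: indep_var_eq)
  have "(\<integral>\<^sup>+\<omega>. indicator {\<omega>. ereal t < \<zeta> \<omega>} \<omega> * ennreal (exp (- s * H t \<omega>)) \<partial>M)
      = (\<integral>\<^sup>+\<omega>. ennreal (A \<omega> * B \<omega>) \<partial>M)"
    by (rule nn_integral_cong) (simp add: A_def B_def ennreal_mult'' ennreal_indicator)
  also have "\<dots> = ennreal (expectation (\<lambda>\<omega>. A \<omega> * B \<omega>))"
    using indep_var_integrable[OF indep \<open>integrable M A\<close> \<open>integrable M B\<close>]
    by (intro nn_integral_eq_integral) (auto simp: A_def B_def)
  also have "expectation (\<lambda>\<omega>. A \<omega> * B \<omega>) = exp (- q * t) * exp (- t * (\<delta> * s + levy_exponent \<mu> s))"
    using indep_var_lebesgue_integral[OF indep \<open>integrable M A\<close> \<open>integrable M B\<close>] EA EB by simp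
  also have "\<dots> = exp (- (q + \<delta> * s + levy_exponent \<mu> s) * t)"
    by (simp add: exp_add[symmetric] algebra_simps)
  finally show ?thesis .
qed

text \<open>The renewal measure is the image of \<open>M \<otimes> dt\<close>, restricted to the times before killing, under the
  map \<open>(\<omega>, t) \<mapsto> H t \<omega>\<close>. By Fubini its transform is the integral over \<open>t\<close> of
  \<open>exp (- (q + \<delta> * s + levy_exponent \<mu> s) * t)\<close>.\<close>

lemma laplace_renewal_measure:
  assumes sub: "subordinator M H" and char: "has_drift_and_levy_measure M H \<delta> \<mu>"
    and kill: "killing_time M H q \<zeta>" and "0 < \<delta>" and s: "0 < s"
  shows "(\<integral>\<^sup>+x. ennreal (exp (- s * x)) \<partial>renewal_measure M (killed H \<zeta>))
    = ennreal (1 / (q + \<delta> * s + levy_exponent \<mu> s))"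
proof -
  interpret prob_space M
    using sub by (simp add: subordinator_def)
  interpret pair_sigma_finite M lborel ..
  have [measurable]: "\<zeta> \<in> borel_measurable M"
    using kill by (simp add: killing_time_def)
  have "AE \<omega> in M. \<forall>t\<ge>0. ((\<lambda>s. H s \<omega>) \<longlongrightarrow> H t \<omega>) (at_right t)"
    using sub by (simp add: subordinator_def)
  then obtain N where N: "N \<in> null_sets M"
    "{\<omega> \<in> space M. \<not> (\<forall>t\<ge>0. ((\<lambda>s. H s \<omega>) \<longlongrightarrow> H t \<omega>) (at_right t))} \<subseteq> N"
    by (auto simp: eventually_ae_filter)
  then have [measurable]: "N \<in> sets M"
    by auto
  \<comment> \<open>Paths are right-continuous only almost surely; setting the others to \<open>0\<close> makes the process
    jointly measurable without changing the integral over \<open>M\<close>.\<close>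
  define X where "X t \<omega> = (if \<omega> \<in> N then 0 else H t \<omega>)" for t \<omega>
  define Y where "Y p = X (max 0 (snd p)) (fst p)" for p :: "'a \<times> real"
  have [measurable]: "Y \<in> borel_measurable (M \<Otimes>\<^sub>M lborel)"
    unfolding Y_def
  proof (rule right_continuous_process_jointly_measurable)
    show "X t \<in> borel_measurable M" if "0 \<le> t" for t
    proof -
      have [measurable]: "H t \<in> borel_measurable M"
        using sub that by (simp add: subordinator_def)
      show ?thesis unfolding X_def by measurable
    qed
    show "((\<lambda>s. X s \<omega>) \<longlongrightarrow> X t \<omega>) (at_right t)" if "0 \<le> t" "\<omega> \<in> space M" for t \<omega>
      using N(2) that by (cases "\<omega> \<in> N") (auto simp: X_def)
  qed
  define d where "d p = (indicator {0..} (snd p) * (if ereal (snd p) < \<zeta> (fst p) then 1 else 0) :: ennreal)"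
    for p :: "'a \<times> real"
  have [measurable]: "snd \<in> borel_measurable (M \<Otimes>\<^sub>M lborel)"
    using measurable_snd[of M "lborel :: real measure"] by (simp add: measurable_cong_sets[OF refl sets_lborel])
  have [measurable]: "Measurable.pred (M \<Otimes>\<^sub>M lborel) (\<lambda>p. ereal (snd p) < \<zeta> (fst p))"
    by measurable
  have [measurable]: "d \<in> borel_measurable (M \<Otimes>\<^sub>M lborel)"
    unfolding d_def[abs_def] by measurable
  define V where "V = distr (density (M \<Otimes>\<^sub>M lborel) d) borel Y"
  have AE_X: "AE \<omega> in M. X t \<omega> = H t \<omega>" for t
    using AE_not_in[OF N(1)] by eventually_elim (simp add: X_def)
  have nn_V: "(\<integral>\<^sup>+x. g x \<partial>V) = (\<integral>\<^sup>+p. d p * g (Y p) \<partial>(M \<Otimes>\<^sub>M lborel))"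
    if [measurable]: "g \<in> borel_measurable borel" for g :: "real \<Rightarrow> ennreal"
    unfolding V_def by (simp add: nn_integral_distr nn_integral_density)
  have "renewal_measure M (killed H \<zeta>) = measure_of UNIV (sets borel) (emeasure V)"
    unfolding renewal_measure_def
  proof (rule measure_of_eq)
    fix S :: "real set" assume "S \<in> sigma_sets UNIV (sets borel)"
    then have [measurable]: "S \<in> sets borel"
      using sets.sigma_sets_eq[of "borel :: real measure"] by simp
    have "emeasure V S = (\<integral>\<^sup>+x. indicator S x \<partial>V)"
      by (simp add: V_def)
    also have "\<dots> = (\<integral>\<^sup>+\<omega>. (\<integral>\<^sup>+t. d (\<omega>, t) * indicator S (Y (\<omega>, t)) \<partial>lborel) \<partial>M)"
      by (simp add: nn_V lborel.nn_integral_fst[symmetric])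
    also have "\<dots> = (\<integral>\<^sup>+\<omega>. (\<integral>\<^sup>+t\<in>{0..}. indicator (Some ` S) (killed H \<zeta> t \<omega>) \<partial>lborel) \<partial>M)"
      using AE_not_in[OF N(1)]
    proof (intro nn_integral_cong_AE, eventually_elim)
      fix \<omega> assume "\<omega> \<notin> N"
      then show "(\<integral>\<^sup>+t. d (\<omega>, t) * indicator S (Y (\<omega>, t)) \<partial>lborel)
          = (\<integral>\<^sup>+t\<in>{0..}. indicator (Some ` S) (killed H \<zeta> t \<omega>) \<partial>lborel)"
        by (intro nn_integral_cong) (auto simp: d_def Y_def X_def killed_def indicator_def max_def)
    qed
    finally show "(\<integral>\<^sup>+\<omega>. (\<integral>\<^sup>+t\<in>{0..}. indicator (Some ` S) (killed H \<zeta> t \<omega>) \<partial>lborel) \<partial>M) = emeasure V S"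
      by simp
  qed simp
  also have "\<dots> = V"
    using measure_of_of_measure[of V] by (simp add: V_def)
  finally have "(\<integral>\<^sup>+x. ennreal (exp (- s * x)) \<partial>renewal_measure M (killed H \<zeta>))
      = (\<integral>\<^sup>+p. d p * ennreal (exp (- s * Y p)) \<partial>(M \<Otimes>\<^sub>M lborel))"
    by (simp add: nn_V)
  also have "\<dots> = (\<integral>\<^sup>+t. (\<integral>\<^sup>+\<omega>. d (\<omega>, t) * ennreal (exp (- s * Y (\<omega>, t))) \<partial>M) \<partial>lborel)"
    by (rule nn_integral_snd[symmetric]) measurable
  also have "\<dots> = laplace (q + \<delta> * s + levy_exponent \<mu> s) (indicator {0<..})"
    unfolding laplace_def using AE_lborel_singleton[of 0]
  proof (intro nn_integral_cong_AE, eventually_elim)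
    fix t :: real assume "t \<noteq> 0"
    show "(\<integral>\<^sup>+\<omega>. d (\<omega>, t) * ennreal (exp (- s * Y (\<omega>, t))) \<partial>M)
        = ennreal (exp (- (q + \<delta> * s + levy_exponent \<mu> s) * t)) * indicator {0<..} t"
    proof (cases "0 < t")
      case True
      have "(\<integral>\<^sup>+\<omega>. d (\<omega>, t) * ennreal (exp (- s * Y (\<omega>, t))) \<partial>M)
          = (\<integral>\<^sup>+\<omega>. indicator {\<omega>. ereal t < \<zeta> \<omega>} \<omega> * ennreal (exp (- s * H t \<omega>)) \<partial>M)"
        using AE_X[of t]
        by (intro nn_integral_cong_AE, eventually_elim) (use True in \<open>auto simp: d_def Y_def indicator_def\<close>)
      then show ?thesis
        using nn_integral_killed_exp[OF sub char kill, of t s] True s by simp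
    next
      case False
      then show ?thesis using \<open>t \<noteq> 0\<close> by (simp add: d_def)
    qed
  qed
  also have "\<dots> = ennreal (1 / (q + \<delta> * s + levy_exponent \<mu> s))"
  proof (rule laplace_indicator_halfline)
    have "0 \<le> q" using kill by (simp add: killing_time_def)
    moreover have "0 \<le> levy_exponent \<mu> s"
      using char s by (intro levy_exponent_nonneg) (auto simp: has_drift_and_levy_measure_def)
    ultimately show "0 < q + \<delta> * s + levy_exponent \<mu> s"
      using \<open>0 < \<delta>\<close> s by (simp add: add_pos_nonneg add_nonneg_pos)
  qed
  finally show ?thesis .
qed

section \<open>Identification of the renewal density\<close>

text \<open>In \<open>\<integral> \<eta>\<^sup>*\<^sup>n(x - y) * \<pi>(y)\<close> the end point \<open>y = x\<close> evaluates \<open>\<eta>\<^sup>*\<^sup>n\<close> at \<open>0\<close>, where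
  \<open>\<eta>\<^sup>*\<^sup>0\<close> is \<open>1\<close> but \<open>prim 0\<close> vanishes. Changing a function at one point affects neither its
  integral nor its measurability.\<close>

lemma set_integral_cong_except_right_end:
  fixes f g :: "real \<Rightarrow> real"
  assumes [measurable]: "g \<in> borel_measurable borel"
    and eq: "\<And>y. y \<in> {0..<x} \<Longrightarrow> f y = g y"
  shows "(LINT y:{0..x}|lborel. f y) = (LINT y:{0..x}|lborel. g y)"
proof -
  let ?f = "\<lambda>y. indicator {0..x} y *\<^sub>R f y" and ?g = "\<lambda>y. indicator {0..x} y *\<^sub>R g y"
  have f: "?f = (\<lambda>y. if y = x then ?f x else ?g y)"
    using eq by (auto simp: fun_eq_iff indicator_def)
  have "?f \<in> borel_measurable borel"
    by (subst f) measurable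
  moreover have "AE y in lborel. ?f y = ?g y"
    using AE_lborel_singleton[of x] by eventually_elim (use eq in \<open>auto simp: indicator_def\<close>)
  ultimately show ?thesis
    unfolding set_lebesgue_integral_def by (intro integral_cong_AE) auto
qed

theorem corollary9:
  fixes M :: "'a measure" and H :: "real \<Rightarrow> 'a \<Rightarrow> real" and \<zeta> :: "'a \<Rightarrow> ereal"
    and q \<delta> :: real and \<mu> :: "real measure" and u :: "real \<Rightarrow> real"
  assumes "subordinator M H"
    and "has_drift_and_levy_measure M H \<delta> \<mu>"
    and "killing_time M H q \<zeta>"
    and "\<delta> > 0"
    and "\<forall>x>0. emeasure \<mu> {x} = 0"
    and "is_renewal_density (renewal_measure M (killed H \<zeta>)) u"
  shows "(\<forall>x>0. (\<lambda>n. eta_conv q \<mu> n x / \<delta> ^ (n + 1)) sums u x) \<and>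
    (\<forall>x>0. u differentiable (at x)) \<and>
    continuous_on {0<..} (deriv u) \<and>
    (\<forall>n. \<forall>x>0. eta_conv q \<mu> n differentiable (at x)) \<and>
    (\<forall>x>0. (\<lambda>n. deriv (eta_conv q \<mu> n) x / \<delta> ^ (n + 1)) sums deriv u x)"
proof -
  have levy: "subordinator_levy_measure \<mu>"
    using assms(2) by (simp add: has_drift_and_levy_measure_def)
  have q: "0 \<le> q"
    using assms(3) by (simp add: killing_time_def)
  have ucont: "continuous_on {0<..} u" and unonneg: "\<And>x. 0 < x \<Longrightarrow> 0 \<le> u x"
    and U: "renewal_measure M (killed H \<zeta>) = density lborel (\<lambda>x. indicator {0<..} x * ennreal (u x))"
    using assms(6) by (auto simp: is_renewal_density_def)
  define c where "c s = (q + levy_exponent \<mu> s) / s" for s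
  have exponent_nonneg: "0 \<le> c s" if "0 < s" for s
    using q levy_exponent_nonneg[OF levy, of s] that by (simp add: c_def)
  have laplace_tail: "laplace s (\<lambda>x. indicator {0<..} x * ennreal (levy_tail q \<mu> x)) = ennreal (c s)"
    if "0 < s" for s
    unfolding c_def by (rule laplace_levy_tail[OF levy that q])
  have "(\<lambda>n. q / real n + levy_exponent \<mu> (real n) / real n) \<longlonglongrightarrow> 0 + 0"
    by (intro tendsto_add levy_exponent_sublinear[OF levy] lim_const_over_n)
  then have "(\<lambda>n. c (real n)) \<longlonglongrightarrow> 0"
    by (simp add: c_def[abs_def] add_divide_distrib)
  then have "eventually (\<lambda>n. c (real n) < \<delta>) sequentially"
    using \<open>\<delta> > 0\<close> by (rule order_tendstoD(2))
  then have "eventually (\<lambda>n. c (real n) < \<delta> \<and> 0 < n) sequentially"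
    using eventually_gt_at_top[of 0] by eventually_elim auto
  then obtain m where "c (real m) < \<delta>" "0 < m"
    by (auto simp: eventually_sequentially)
  \<comment> \<open>The transform of the tail at \<open>\<theta>\<close> is now smaller than the drift, so the series converges.\<close>
  define \<theta> where "\<theta> = real m"
  have \<theta>: "0 < \<theta>" "c \<theta> < \<delta>"
    using \<open>c (real m) < \<delta>\<close> \<open>0 < m\<close> by (auto simp: \<theta>_def)
  interpret renewal_series "levy_tail q \<mu>" \<theta> "c \<theta>" \<delta>
    by unfold_locales
      (use levy_tail_measurable[OF levy] levy_tail_nonneg[OF levy q] levy_tail_antimono[OF levy]
        continuous_levy_tail[OF levy assms(5)] \<theta> exponent_nonneg laplace_tail in auto)
  have eta_conv_eq: "eta_conv q \<mu> n x = (-1) ^ n * enn2real (prim n x)" if "0 < x" for n x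
    using that
  proof (induction n arbitrary: x)
    case 0
    then show ?case by (simp add: prim_def)
  next
    case (Suc n)
    have "(LINT y:{0..x}|lborel. eta_conv q \<mu> n (x - y) * levy_tail q \<mu> y)
        = (LINT y:{0..x}|lborel. (-1) ^ n * (enn2real (prim n (x - y)) * levy_tail q \<mu> y))"
    proof (rule set_integral_cong_except_right_end)
      have [measurable]: "levy_tail q \<mu> \<in> borel_measurable borel"
        by (rule levy_tail_measurable[OF levy])
      show "(\<lambda>y. (-1) ^ n * (enn2real (prim n (x - y)) * levy_tail q \<mu> y)) \<in> borel_measurable borel"
        by measurable
    qed (simp add: Suc.IH)
    then show ?case
      using prim_Suc_eq_set_integral[OF Suc.prems, of n] by simp
  qed
  have eta_conv_term: "eta_conv q \<mu> n x / \<delta> ^ (n + 1) = renewal_term n x" if "0 < x" for n x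
    using eta_conv_eq[OF that] by (simp add: renewal_term_def)
  have eta_conv_deriv: "(eta_conv q \<mu> n has_real_derivative (-1) ^ n * prim' n x) (at x)" if "0 < x" for n x
  proof (rule has_field_derivative_transform_within_open)
    show "((\<lambda>x. (-1) ^ n * enn2real (prim n x)) has_real_derivative (-1) ^ n * prim' n x) (at x)"
      by (intro DERIV_cmult prim_has_derivative_prim' that)
    show "open {0::real<..}" "x \<in> {0<..}"
      using that by auto
    show "(-1) ^ n * enn2real (prim n y) = eta_conv q \<mu> n y" if "y \<in> {0<..}" for y
      using that eta_conv_eq by simp
  qed
  have renewal_cont: "continuous_on {0<..} renewal_sum"
    by (intro continuous_at_imp_continuous_on ballI DERIV_isCont[OF renewal_sum_has_derivative]) simp
  have u_eq: "u x = renewal_sum x" if "0 < x" for x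
  proof -
    define w where "w x = u x - renewal_sum x" for x
    have u_meas [measurable]: "(\<lambda>x. indicator {0<..} x * u x) \<in> borel_measurable borel"
      using borel_measurable_continuous_on_indicator[OF _ ucont] by simp
    have lap_u: "integrable lborel (\<lambda>x. indicator {0<..} x * (exp (- s * x) * u x))"
      "(LINT x|lborel. indicator {0<..} x * (exp (- s * x) * u x)) = 1 / (q + \<delta> * s + levy_exponent \<mu> s)"
      if "0 < s" for s
    proof -
      let ?f = "\<lambda>x. indicator {0<..} x * (exp (- s * x) * u x)"
      have f_eq: "?f = (\<lambda>x. exp (- s * x) * (indicator {0<..} x * u x))"
        by (simp add: fun_eq_iff)
      have meas: "?f \<in> borel_measurable borel"
        unfolding f_eq by measurable
      have nonneg: "0 \<le> ?f x" for x
        using unonneg[of x] by (cases "0 < x") auto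
      have dens: "(\<lambda>x. indicator {0<..} x * ennreal (u x)) = (\<lambda>x. ennreal (indicator {0<..} x * u x))"
        by (auto simp: fun_eq_iff indicator_def)
      have "(\<integral>\<^sup>+x. ennreal (exp (- s * x)) \<partial>renewal_measure M (killed H \<zeta>))
          = (\<integral>\<^sup>+x. ennreal (indicator {0<..} x * u x) * ennreal (exp (- s * x)) \<partial>lborel)"
        unfolding U dens using measurable_compose[OF u_meas measurable_ennreal]
        by (intro nn_integral_density) (simp_all add: borel_measurable_exp)
      also have "\<dots> = (\<integral>\<^sup>+x. ennreal (?f x) \<partial>lborel)"
        by (rule nn_integral_cong) (auto simp: ennreal_mult'' indicator_def mult.commute)
      finally have "(\<integral>\<^sup>+x. ennreal (?f x) \<partial>lborel)
          = (\<integral>\<^sup>+x. ennreal (exp (- s * x)) \<partial>renewal_measure M (killed H \<zeta>))"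
        by (rule sym)
      also have "\<dots> = ennreal (1 / (q + \<delta> * s + levy_exponent \<mu> s))"
        by (rule laplace_renewal_measure[OF assms(1-4) that])
      finally have "(\<integral>\<^sup>+x. ennreal (?f x) \<partial>lborel) = ennreal (1 / (q + \<delta> * s + levy_exponent \<mu> s))" .
      moreover have "0 \<le> 1 / (q + \<delta> * s + levy_exponent \<mu> s)"
        using q \<open>\<delta> > 0\<close> that levy_exponent_nonneg[OF levy, of s] by simp
      ultimately show "integrable lborel ?f"
        "(LINT x|lborel. ?f x) = 1 / (q + \<delta> * s + levy_exponent \<mu> s)"
        using nn_integral_eq_integrable[of ?f lborel "1 / (q + \<delta> * s + levy_exponent \<mu> s)"]
          meas nonneg by simp_all
    qed
    have lap_w: "integrable lborel (\<lambda>x. indicator {0<..} x * (exp (- s * x) * w x))"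
      "(LINT x|lborel. indicator {0<..} x * (exp (- s * x) * w x)) = 0" if "\<theta> \<le> s" for s
    proof -
      have s: "0 < s" using that \<theta> by simp
      note r = laplace_renewal_sum[OF that laplace_tail[OF s, folded ker_def[abs_def]] exponent_nonneg[OF s]]
      have *: "indicator {0<..} x * (exp (- s * x) * w x) = indicator {0<..} x * (exp (- s * x) * u x)
          - indicator {0<..} x * (exp (- s * x) * renewal_sum x)" for x
        by (simp add: w_def algebra_simps)
      have "q + \<delta> * s + levy_exponent \<mu> s = s * (\<delta> + c s)"
        using s by (simp add: c_def field_simps)
      then show "integrable lborel (\<lambda>x. indicator {0<..} x * (exp (- s * x) * w x))"
        "(LINT x|lborel. indicator {0<..} x * (exp (- s * x) * w x)) = 0"
        unfolding * using r lap_u[OF s] by simp_all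
    qed
    have "w x = 0"
    proof (rule laplace_transform_eq_zero_imp_eq_zero[where s = \<theta> and w = w and ?x0.0 = x])
      show "continuous_on {0<..} w"
        unfolding w_def[abs_def] by (intro continuous_intros ucont renewal_cont)
      show "integrable lborel (\<lambda>x. indicator {0<..} x * (exp (- \<theta> * x) * w x))"
        by (rule lap_w) simp
      show "(LINT x|lborel. indicator {0<..} x * (exp (- (\<theta> + real n) * x) * w x)) = 0" for n
        by (rule lap_w) simp
    qed (rule that)
    then show ?thesis by (simp add: w_def)
  qed
  have u_deriv: "(u has_real_derivative renewal_sum' x) (at x)" if "0 < x" for x
    by (rule has_field_derivative_transform_within_open[OF renewal_sum_has_derivative[OF that], of "{0<..}"])
      (use that u_eq in auto)
  have deriv_u: "deriv u x = renewal_sum' x" if "0 < x" for x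
    using u_deriv[OF that] by (rule DERIV_imp_deriv)
  have deriv_eta: "deriv (eta_conv q \<mu> n) x / \<delta> ^ (n + 1) = renewal_term' n x" if "0 < x" for n x
    using DERIV_imp_deriv[OF eta_conv_deriv[OF that]] by (simp add: renewal_term'_def)
  show ?thesis
  proof (intro conjI allI impI)
    fix x :: real assume x: "0 < x"
    show "(\<lambda>n. eta_conv q \<mu> n x / \<delta> ^ (n + 1)) sums u x"
      using summable_sums[OF summable_renewal_term[of x]] x
      by (simp only: eta_conv_term u_eq renewal_sum_def)
    show "u differentiable (at x)"
      using u_deriv[OF x] by (auto simp: real_differentiable_def)
    show "eta_conv q \<mu> n differentiable (at x)" for n
      using eta_conv_deriv[OF x] by (auto simp: real_differentiable_def)
    show "(\<lambda>n. deriv (eta_conv q \<mu> n) x / \<delta> ^ (n + 1)) sums deriv u x"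
      using renewal_sum'_sums[OF x] x by (simp only: deriv_eta deriv_u)
  next
    show "continuous_on {0<..} (deriv u)"
      using continuous_renewal_sum' by (rule continuous_on_eq) (simp add: deriv_u)
  qed
qed

end
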